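(* Let $W$ be a matrix weight of size $N$ on an interval $(a,b)$ and let $$A_nP_{n-1}(x)+B_nP_n(x)+P_{n+1}(x)=xP_n(x),\qquad n\in\mathbb N_0,$$ be the three term recursion relation satisfied by the corresponding sequence of monic orthogonal polynomials $\{P_n\}_{n\in\mathbb N_0}$ (with $A_n,B_n\in\mathrm{Mat}_N(\mathbb C)$, $P_{-1}=0$ and $A_0=0$). If $W$ reduces, then there is a non-scalar matrix $T\in\mathrm{Mat}_N(\mathbb C)$ commuting with $A_n$ and $B_n$ for all $n\in\mathbb N_0$. Moreover, if $a,b\in\mathbb R$ (i.e. the interval is finite), then the converse is also true: if there is a non-scalar matrix commuting with all $A_n$ and $B_n$, then $W$ reduces.
   Context: A matrix weight of size $N$ on an interval $(a,b)\subseteq\mathbb R$ (possibly unbounded) is an integrable function $W:(a,b)\to\mathrm{Mat}_N(\mathbb C)$ such that $W(x)$ is positive semidefinite for all $x\in(a,b)$, positive definite for almost every $x$, and with finite moments $\int_a^b x^nW(x)\,dx$ of all orders $n\ge0$. The monic orthogonal polynomials $\{P_n\}_{n\ge0}$ of $W$ are the unique polynomials $P_n\in\mathrm{Mat}_N(\mathbb C)[x]$ of degree $n$ with leading coefficient $I$ such that $\int_a^bP_n(x)W(x)P_m(x)^*dx=0$ for $n\neq m$; they satisfy a three term recursion relation of the displayed form. Two matrix weights $W,W'$ of the same size on the same interval are equivalent if there is a nonsingular constant matrix $M$ with $W'(x)=MW(x)M^*$ for all $x$. $W$ reduces if it is equivalent to a direct sum (block diagonal weight) of matrix weights of smaller size.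 Weights are identified when they agree almost everywhere, so "for all $x$" in the definition of equivalence is understood as "for almost every $x$". A matrix is scalar if it is of the form $cI$, $c\in\mathbb C$. *)

theory Defs
  imports "HOL-Analysis.Analysis" "Jordan_Normal_Form.Schur_Decomposition"
begin

text \<open>The order on \<^typ>\<open>complex\<close> is that of \<open>HOL-Library.Complex_Order\<close>:
  \<open>0 \<le> z\<close> means that \<open>z\<close> is real and nonnegative, and likewise for \<open>0 < z\<close>.
  So the two conditions below include that the matrix is Hermitian.\<close>

definition pos_semidefinite :: "nat \<Rightarrow> complex mat \<Rightarrow> bool" where
  "pos_semidefinite N A \<longleftrightarrow>
     A \<in> carrier_mat N N \<and> (\<forall>v \<in> carrier_vec N. 0 \<le> (A *\<^sub>v v) \<bullet>c v)"

definition pos_definite :: "nat \<Rightarrow> complex mat \<Rightarrow> bool" where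
  "pos_definite N A \<longleftrightarrow>
     A \<in> carrier_mat N N \<and> (\<forall>v \<in> carrier_vec N. v \<noteq> 0\<^sub>v N \<longrightarrow> 0 < (A *\<^sub>v v) \<bullet>c v)"

definition scalar_matrix :: "nat \<Rightarrow> complex mat \<Rightarrow> bool" where
  "scalar_matrix N T \<longleftrightarrow> (\<exists>c. T = c \<cdot>\<^sub>m 1\<^sub>m N)"

text \<open>Weights are functions on all of \<^typ>\<open>real\<close>; only their values on
  \<open>einterval a b = {x. a < ereal x \<and> ereal x < b}\<close> matter.  The case \<open>n = 0\<close> of the moment
  condition is the integrability of \<open>W\<close>.\<close>

definition matrix_weight :: "nat \<Rightarrow> ereal \<Rightarrow> ereal \<Rightarrow> (real \<Rightarrow> complex mat) \<Rightarrow> bool" where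
  "matrix_weight N a b W \<longleftrightarrow>
     0 < N \<and> a < b \<and>
     (\<forall>x \<in> einterval a b. pos_semidefinite N (W x)) \<and>
     (AE x in lebesgue. x \<in> einterval a b \<longrightarrow> pos_definite N (W x)) \<and>
     (\<forall>n. \<forall>i<N. \<forall>j<N.
        set_integrable lebesgue (einterval a b) (\<lambda>x. of_real (x ^ n) * (W x $$ (i, j))))"

text \<open>Matrix-valued integrals are taken entrywise.  The entries are integrable wherever this is
  used below, since a weight has finite moments of all orders.\<close>

definition mat_integral :: "nat \<Rightarrow> ereal \<Rightarrow> ereal \<Rightarrow> (real \<Rightarrow> complex mat) \<Rightarrow> complex mat" where
  "mat_integral N a b F =
     mat N N (\<lambda>(i, j). set_lebesgue_integral lebesgue (einterval a b) (\<lambda>x. F x $$ (i, j)))"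

text \<open>A polynomial with coefficients in the \<open>N \<times> N\<close> matrices is encoded as a matrix of
  polynomials.\<close>

definition mpoly_coeff :: "complex poly mat \<Rightarrow> nat \<Rightarrow> complex mat" where
  "mpoly_coeff P k = map_mat (\<lambda>p. coeff p k) P"

definition mpoly_eval :: "complex poly mat \<Rightarrow> real \<Rightarrow> complex mat" where
  "mpoly_eval P x = map_mat (\<lambda>p. poly p (of_real x)) P"

definition monic_mpoly :: "nat \<Rightarrow> nat \<Rightarrow> complex poly mat \<Rightarrow> bool" where
  "monic_mpoly N n P \<longleftrightarrow>
     P \<in> carrier_mat N N \<and> mpoly_coeff P n = 1\<^sub>m N \<and> (\<forall>k>n. mpoly_coeff P k = 0\<^sub>m N N)"

definition monic_orthogonal_polys ::
  "nat \<Rightarrow> ereal \<Rightarrow> ereal \<Rightarrow> (real \<Rightarrow> complex mat) \<Rightarrow> (nat \<Rightarrow> complex poly mat) \<Rightarrow> bool" where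
  "monic_orthogonal_polys N a b W P \<longleftrightarrow>
     (\<forall>n. monic_mpoly N n (P n)) \<and>
     (\<forall>n m. n \<noteq> m \<longrightarrow>
        mat_integral N a b (\<lambda>x. mpoly_eval (P n) x * W x * mat_adjoint (mpoly_eval (P m) x))
          = 0\<^sub>m N N)"

text \<open>The \<open>if\<close> encodes \<open>P\<^bsub>-1\<^esub> = 0\<close>.\<close>

definition three_term_recursion ::
  "nat \<Rightarrow> (nat \<Rightarrow> complex mat) \<Rightarrow> (nat \<Rightarrow> complex mat) \<Rightarrow> (nat \<Rightarrow> complex poly mat) \<Rightarrow> bool" where
  "three_term_recursion N A B P \<longleftrightarrow>
     (\<forall>n. A n \<in> carrier_mat N N \<and> B n \<in> carrier_mat N N) \<and>
     A 0 = 0\<^sub>m N N \<and>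
     (\<forall>n x. A n * (if n = 0 then 0\<^sub>m N N else mpoly_eval (P (n - 1)) x)
              + B n * mpoly_eval (P n) x + mpoly_eval (P (Suc n)) x
            = of_real x \<cdot>\<^sub>m mpoly_eval (P n) x)"

definition weight_equiv ::
  "nat \<Rightarrow> ereal \<Rightarrow> ereal \<Rightarrow> (real \<Rightarrow> complex mat) \<Rightarrow> (real \<Rightarrow> complex mat) \<Rightarrow> bool" where
  "weight_equiv N a b W W' \<longleftrightarrow>
     (\<exists>M \<in> carrier_mat N N. invertible_mat M \<and>
        (AE x in lebesgue. x \<in> einterval a b \<longrightarrow> W' x = M * W x * mat_adjoint M))"

text \<open>In \<open>(k, V)\<close>, the number \<open>k\<close> is the size of the summand \<open>V\<close>.\<close>

definition weight_direct_sum :: "(nat \<times> (real \<Rightarrow> complex mat)) list \<Rightarrow> real \<Rightarrow> complex mat" where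
  "weight_direct_sum Vs x = diag_block_mat (map (\<lambda>(k, V). V x) Vs)"

definition weight_reduces :: "nat \<Rightarrow> ereal \<Rightarrow> ereal \<Rightarrow> (real \<Rightarrow> complex mat) \<Rightarrow> bool" where
  "weight_reduces N a b W \<longleftrightarrow>
     (\<exists>Vs. (\<forall>(k, V) \<in> set Vs. k < N \<and> matrix_weight k a b V) \<and>
           sum_list (map fst Vs) = N \<and>
           weight_equiv N a b W (weight_direct_sum Vs))"

end

theory Submission
  imports Defs "Jordan_Normal_Form.Spectral_Radius"
begin

text \<open>
  If \<open>M W M\<^sup>*\<close> is block diagonal and \<open>F\<close> is the projection onto the first block, then
  \<open>T = M\<^sup>-\<^sup>1 F M\<close> satisfies \<open>T W = W T\<^sup>*\<close>.  Hence right multiplication by \<open>T\<close> is symmetric for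
  the matrix inner product of \<open>W\<close>, so \<open>T P\<^sub>n - P\<^sub>n T\<close>, of degree less than \<open>n\<close>, is orthogonal to
  itself and vanishes; comparing coefficients in the recursion, \<open>T\<close> commutes with all
  \<open>A\<^sub>n\<close> and \<open>B\<^sub>n\<close>.

  Conversely, if \<open>T\<close> commutes with all \<open>A\<^sub>n\<close> and \<open>B\<^sub>n\<close>, it commutes with all \<open>P\<^sub>n\<close>, and expanding
  \<open>x\<^sup>n\<close> in the \<open>P\<^sub>k\<close> shows that the moments are \<open>\<mu>\<^sub>n = C\<^sub>n \<mu>\<^sub>0\<close> with \<open>C\<^sub>n T = T C\<^sub>n\<close>.  So
  \<open>T \<mu>\<^sub>n = \<mu>\<^sub>n U\<close> for \<open>U = \<mu>\<^sub>0\<^sup>-\<^sup>1 T \<mu>\<^sub>0\<close>, and on a bounded interval the moments determine an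
  integrable function, whence \<open>T W = W U\<close>.  One of \<open>U + T\<^sup>*\<close> and \<open>i (U - T\<^sup>*)\<close> is then a
  non-scalar \<open>Y\<close> with \<open>W Y = Y\<^sup>* W\<close>.  For an eigenvalue \<open>c\<close> of \<open>Y\<close>, which is real, the kernel and
  the range of \<open>Y - c\<close> are complementary and orthogonal for every \<open>W(x)\<close>, which splits \<open>W\<close>.
\<close>

section \<open>Adjoints and definite matrices\<close>

lemma mat_adjoint_index [simp]:
  fixes A :: "complex mat"
  assumes "i < dim_col A" "j < dim_row A"
  shows "mat_adjoint A $$ (i, j) = cnj (A $$ (j, i))"
  using assms unfolding mat_adjoint_def by (simp add: mat_of_rows_def)

lemma mat_adjoint_carrier:
  fixes A :: "complex mat"
  assumes "A \<in> carrier_mat n m"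
  shows "mat_adjoint A \<in> carrier_mat m n"
  using assms unfolding mat_adjoint_def by auto

lemma mat_adjoint_dim [simp]:
  fixes A :: "complex mat"
  shows "dim_row (mat_adjoint A) = dim_col A" "dim_col (mat_adjoint A) = dim_row A"
  unfolding mat_adjoint_def by auto

lemma mat_adjoint_carrier_iff [simp]:
  fixes A :: "complex mat"
  shows "mat_adjoint A \<in> carrier_mat m n \<longleftrightarrow> A \<in> carrier_mat n m"
  unfolding carrier_mat_def by auto

lemma mat_adjoint_adjoint [simp]:
  fixes A :: "complex mat"
  shows "mat_adjoint (mat_adjoint A) = A"
  by (rule eq_matI) auto

lemma mat_adjoint_mult:
  fixes A B :: "complex mat"
  assumes "A \<in> carrier_mat n m" "B \<in> carrier_mat m l"
  shows "mat_adjoint (A * B) = mat_adjoint B * mat_adjoint A"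
  using assms
  by (intro eq_matI) (auto simp: scalar_prod_def mult.commute intro!: sum.cong)

lemma mat_adjoint_minus:
  fixes A B :: "complex mat"
  assumes "A \<in> carrier_mat n m" "B \<in> carrier_mat n m"
  shows "mat_adjoint (A - B) = mat_adjoint A - mat_adjoint B"
  using assms by (intro eq_matI) auto

lemma mat_adjoint_smult:
  fixes A :: "complex mat"
  shows "mat_adjoint (c \<cdot>\<^sub>m A) = cnj c \<cdot>\<^sub>m mat_adjoint A"
  by (intro eq_matI) auto

lemma mat_adjoint_one [simp]: "mat_adjoint (1\<^sub>m n :: complex mat) = 1\<^sub>m n"
  by (intro eq_matI) auto

lemma mat_adjoint_zero [simp]: "mat_adjoint (0\<^sub>m n m :: complex mat) = 0\<^sub>m m n"
  by (intro eq_matI) auto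

text \<open>Positivity of \<open>W\<close> is stated through its quadratic form. This turns the
  diagonal of \<open>A W A\<^sup>*\<close> into values of that form, so that definiteness can be
  applied to diagonal entries.\<close>

lemma mat_adjoint_mult_vec_index:
  fixes A W :: "complex mat"
  assumes "A \<in> carrier_mat n m" "W \<in> carrier_mat m m" "i < n"
  shows "(A * W * mat_adjoint A) $$ (i, i) = (W *\<^sub>v col (mat_adjoint A) i) \<bullet>c col (mat_adjoint A) i"
proof -
  have c: "conjugate (col (mat_adjoint A) i) = row A i"
    using assms by (intro eq_vecI) auto
  have "A * W * mat_adjoint A = A * (W * mat_adjoint A)"
    using assms by (intro assoc_mult_mat) auto
  also have "\<dots> $$ (i, i) = row A i \<bullet> col (W * mat_adjoint A) i"
    using assms by auto
  also have "col (W * mat_adjoint A) i = W *\<^sub>v col (mat_adjoint A) i"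
    using assms by (intro col_mult2[of _ m m _ n]) auto
  finally show ?thesis
    unfolding c using assms by (auto intro!: comm_scalar_prod[of _ m])
qed

lemma mult_mat_vec_cscalar_prod:
  fixes S :: "complex mat"
  assumes "S \<in> carrier_mat k m" "w \<in> carrier_vec m" "v \<in> carrier_vec k"
  shows "(S *\<^sub>v w) \<bullet>c v = w \<bullet>c (mat_adjoint S *\<^sub>v v)"
proof -
  have "(S *\<^sub>v w) \<bullet>c v = (\<Sum>i<k. \<Sum>j<m. S $$ (i, j) * vec_index w j * cnj (vec_index v i))"
    using assms by (auto simp: scalar_prod_def lessThan_atLeast0 sum_distrib_right intro!: sum.cong)
  also have "\<dots> = (\<Sum>j<m. \<Sum>i<k. S $$ (i, j) * vec_index w j * cnj (vec_index v i))"
    by (rule sum.swap)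
  also have "\<dots> = w \<bullet>c (mat_adjoint S *\<^sub>v v)"
    using assms by (auto simp: scalar_prod_def lessThan_atLeast0 sum_distrib_left mult_ac intro!: sum.cong)
  finally show ?thesis .
qed

text \<open>Polarization: the form is real at every vector, and its values at
  \<open>e\<^sub>i + c e\<^sub>j\<close> for \<open>c = 1\<close> and \<open>c = \<i>\<close>
  compare the entries at \<open>(i, j)\<close> and \<open>(j, i)\<close>.\<close>

lemma pos_semidefinite_hermitian:
  assumes "pos_semidefinite n A"
  shows "mat_adjoint A = A"
proof -
  have A: "A \<in> carrier_mat n n" and pos: "\<And>v. v \<in> carrier_vec n \<Longrightarrow> Im ((A *\<^sub>v v) \<bullet>c v) = 0"
    using assms by (auto simp: pos_semidefinite_def less_eq_complex_def)
  have form: "(A *\<^sub>v v) \<bullet>c v = (\<Sum>p<n. \<Sum>q<n. A $$ (p,q) * v $ q * cnj (v $ p))" if "v \<in> carrier_vec n" for v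
    using A that by (auto simp: scalar_prod_def sum_distrib_right lessThan_atLeast0 intro!: sum.cong)
  have main: "A $$ (i,j) = cnj (A $$ (j,i))" if ij: "i < n" "j < n" for i j
  proof -
    have *: "(A *\<^sub>v v) \<bullet>c v = A $$ (i,i) + c * A $$ (i,j) + cnj c * A $$ (j,i) + c * cnj c * A $$ (j,j)"
      if v: "v = unit_vec n i + c \<cdot>\<^sub>v unit_vec n j" and "i \<noteq> j" for c v
    proof -
      have v': "v $ q = (if q = i then 1 else if q = j then c else 0)" if "q < n" for q
        using that \<open>i \<noteq> j\<close> ij v by auto
      have "(A *\<^sub>v v) \<bullet>c v = (\<Sum>p<n. \<Sum>q<n. A $$ (p,q) * (if q = i then 1 else if q = j then c else 0)
          * cnj (if p = i then 1 else if p = j then c else 0))"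
        using v v' by (subst form) (auto intro!: sum.cong)
      also have "\<dots> = (\<Sum>p\<in>{i,j}. \<Sum>q\<in>{i,j}. A $$ (p,q) * (if q = i then 1 else if q = j then c else 0)
          * cnj (if p = i then 1 else if p = j then c else 0))"
        using ij by (intro sum.mono_neutral_cong_right ballI) auto
      finally show ?thesis using \<open>i \<noteq> j\<close> by (simp add: algebra_simps)
    qed
    have ii: "Im (A $$ (i,i)) = 0" if "i < n" for i
    proof -
      have "(A *\<^sub>v unit_vec n i) \<bullet>c unit_vec n i = A $$ (i,i)"
        using A that by (auto simp: scalar_prod_def unit_vec_def if_distrib sum.delta cong: if_cong)
      then show ?thesis using pos[of "unit_vec n i"] by simp
    qed
    show ?thesis
    proof (cases "i = j")
      case True
      then show ?thesis using ii ij by (simp add: complex_eq_iff)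
    next
      case False
      \<comment> \<open>The diagonal entries are real. Then \<open>c = 1\<close> makes the imaginary
        parts of the two off-diagonal entries cancel, and \<open>c = \<i>\<close> makes their real
        parts agree.\<close>
      show ?thesis
        using pos[of "unit_vec n i + 1 \<cdot>\<^sub>v unit_vec n j", unfolded *[OF refl False]]
          pos[of "unit_vec n i + \<i> \<cdot>\<^sub>v unit_vec n j", unfolded *[OF refl False]]
          ii[OF ij(1)] ii[OF ij(2)]
        by (simp add: complex_eq_iff)
    qed
  qed
  show ?thesis
  proof (rule eq_matI)
    fix i j assume "i < dim_row A" "j < dim_col A"
    then show "mat_adjoint A $$ (i, j) = A $$ (i, j)" using A main[of i j] by simp
  qed (use A in auto)
qed

text \<open>Each diagonal entry is the form of \<open>W\<close> at a column of
  \<open>A\<^sup>*\<close>, so a vanishing diagonal already kills all these columns.\<close>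

lemma pos_definite_eq_zero:
  assumes W: "pos_definite m W" and A: "A \<in> carrier_mat n m"
    and zero: "\<And>i. i < n \<Longrightarrow> (A * W * mat_adjoint A) $$ (i, i) = 0"
  shows "A = 0\<^sub>m n m"
proof (rule eq_matI)
  fix i j assume ij: "i < dim_row (0\<^sub>m n m :: complex mat)" "j < dim_col (0\<^sub>m n m :: complex mat)"
  have "(W *\<^sub>v col (mat_adjoint A) i) \<bullet>c col (mat_adjoint A) i = 0"
    using mat_adjoint_mult_vec_index[of A n m W i] zero ij A W[unfolded pos_definite_def, THEN conjunct1]
    by simp
  then have "col (mat_adjoint A) i = 0\<^sub>v m"
  proof (rule contrapos_pp)
    assume "col (mat_adjoint A) i \<noteq> 0\<^sub>v m"
    moreover have "col (mat_adjoint A) i \<in> carrier_vec m"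
      using ij A by auto
    ultimately have "0 < (W *\<^sub>v col (mat_adjoint A) i) \<bullet>c col (mat_adjoint A) i"
      using W unfolding pos_definite_def by blast
    then show "(W *\<^sub>v col (mat_adjoint A) i) \<bullet>c col (mat_adjoint A) i \<noteq> 0"
      by (rule less_imp_neq[THEN not_sym])
  qed
  then have "vec_index (col (mat_adjoint A) i) j = 0" using ij by simp
  then show "A $$ (i, j) = 0\<^sub>m n m $$ (i, j)" using ij A by simp
qed (use A in auto)

text \<open>A singular \<open>M\<close> has a nonzero row vector \<open>v\<close> with
  \<open>v M = 0\<close>, and stacking copies of \<open>v\<close> gives a nonzero square
  \<open>C\<close> with \<open>C M = 0\<close>. Left cancellation is the form in which invertibility
  is verified below.\<close>

lemma invertible_matI_left_cancel:
  fixes M :: "'a :: field mat"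
  assumes M: "M \<in> carrier_mat n n"
    and inj: "\<And>C. C \<in> carrier_mat n n \<Longrightarrow> C * M = 0\<^sub>m n n \<Longrightarrow> C = 0\<^sub>m n n"
  shows "invertible_mat M"
proof -
  have "det M \<noteq> 0"
  proof
    assume "det M = 0"
    then have "det (transpose_mat M) = 0" using det_transpose[OF M] by simp
    then obtain v where v: "v \<in> carrier_vec n" "v \<noteq> 0\<^sub>v n" "transpose_mat M *\<^sub>v v = 0\<^sub>v n"
      using det_0_iff_vec_prod_zero_field[of "transpose_mat M" n] M by auto
    define C where "C = mat n n (\<lambda>(i, j). v $ j)"
    have "C * M = 0\<^sub>m n n"
    proof (rule eq_matI)
      fix i j assume ij: "i < dim_row (0\<^sub>m n n :: 'a mat)" "j < dim_col (0\<^sub>m n n :: 'a mat)"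
      have "row C i = v" using ij v by (intro eq_vecI) (auto simp: C_def)
      then have "(C * M) $$ (i, j) = v \<bullet> col M j" using ij M by (auto simp: C_def)
      also have "\<dots> = (transpose_mat M *\<^sub>v v) $ j"
        using ij M v(1) by (auto intro!: comm_scalar_prod[of _ n])
      finally show "(C * M) $$ (i, j) = 0\<^sub>m n n $$ (i, j)" using v ij by simp
    qed (use M in \<open>auto simp: C_def\<close>)
    then have "C = 0\<^sub>m n n" by (intro inj[of C]) (auto simp: C_def)
    have "v = 0\<^sub>v n"
    proof (rule eq_vecI)
      fix j assume "j < dim_vec (0\<^sub>v n :: 'a Matrix.vec)"
      then have j: "j < n" by simp
      have "v $ j = C $$ (j, j)" using j by (simp add: C_def)
      then show "v $ j = 0\<^sub>v n $ j" using \<open>C = 0\<^sub>m n n\<close> j by simp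
    qed (use v in simp)
    then show False using v by simp
  qed
  from det_non_zero_imp_unit[OF M this, of "()"]
  obtain L where "L \<in> carrier_mat n n" "L * M = 1\<^sub>m n" "M * L = 1\<^sub>m n"
    by (auto simp: Units_def ring_mat_def)
  then show ?thesis using M unfolding invertible_mat_def inverts_mat_def square_mat.simps by auto
qed

lemma invertible_matE:
  fixes M :: "'a :: semiring_1 mat"
  assumes "invertible_mat M" "M \<in> carrier_mat n n"
  obtains L where "L \<in> carrier_mat n n" "M * L = 1\<^sub>m n" "L * M = 1\<^sub>m n"
proof -
  from assms obtain L where L: "M * L = 1\<^sub>m n" "L * M = 1\<^sub>m (dim_row L)"
    by (auto simp: invertible_mat_def inverts_mat_def)
  have "dim_col (M * L) = n" unfolding L(1) by simp
  then have "dim_col L = n" by simp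
  moreover have "dim_col (L * M) = dim_row L" unfolding L(2) by simp
  then have "dim_row L = n" using assms by simp
  ultimately show ?thesis using that[of L] L by auto
qed

section \<open>Block diagonalization by a self-adjoint intertwiner\<close>

lemma mat_sandwich_index:
  fixes A B W :: "complex mat"
  assumes "A \<in> carrier_mat n m" "W \<in> carrier_mat m l" "B \<in> carrier_mat p l" "i < n" "j < p"
  shows "(A * W * mat_adjoint B) $$ (i, j)
           = (\<Sum>k<m. \<Sum>q<l. A $$ (i, k) * W $$ (k, q) * cnj (B $$ (j, q)))"
  using assms
  by (auto simp: scalar_prod_def sum_distrib_left mult.assoc lessThan_atLeast0 intro!: sum.cong)

text \<open>Gauss-Jordan elimination in the shape used below: \<open>r\<close> counts the nonzero
  rows, \<open>f i\<close> is the pivot column of row \<open>i\<close>, and \<open>P\<close> is the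
  invertible row transformation.\<close>

lemma reduced_row_echelon:
  fixes Z :: "'a :: field mat"
  assumes Z: "Z \<in> carrier_mat n n"
  obtains r f P Q where "r \<le> n"
    "P \<in> carrier_mat n n" "Q \<in> carrier_mat n n" "P * Q = 1\<^sub>m n"
    "\<And>i j. r \<le> i \<Longrightarrow> i < n \<Longrightarrow> j < n \<Longrightarrow> (P * Z) $$ (i, j) = 0"
    "\<And>i. i < r \<Longrightarrow> f i < n"
    "\<And>i k. i < r \<Longrightarrow> k < n \<Longrightarrow> (P * Z) $$ (k, f i) = (if k = i then 1 else 0)"
proof -
  define E where "E = gauss_jordan_single Z"
  note gj = gauss_jordan_single[OF Z E_def[symmetric]]
  obtain P Q where PQ: "E = P * Z" "P \<in> carrier_mat n n" "Q \<in> carrier_mat n n" "P * Q = 1\<^sub>m n"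
    using gj(4) by blast
  have dim: "dim_row E = n" "dim_col E = n" using gj(2) by auto
  obtain f where "pivot_fun E f n" using gj(3) dim unfolding row_echelon_form_def by auto
  note f = pivot_funD[OF dim(1) this]
  \<comment> \<open>A zero row has the pivot value \<open>n\<close>. The guard \<open>i < n\<close>
    lets \<open>i = n\<close> qualify, so that \<open>r = n\<close> when every row has a
    pivot.\<close>
  define r where "r = (LEAST i. i < n \<longrightarrow> f i = n)"
  have r: "r < n \<Longrightarrow> f r = n" and min: "\<And>i. i < r \<Longrightarrow> i < n \<and> f i \<noteq> n"
    unfolding r_def by (metis (mono_tags, lifting) LeastI less_irrefl, metis (mono_tags, lifting) not_less_Least)
  have "r \<le> n" using min[of n] by (meson less_irrefl not_less)
  moreover have "f i = n" if "r \<le> i" "i < n" for i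
    using that
  proof (induction i rule: dec_induct)
    case base
    then show ?case using r by simp
  next
    case (step i)
    then show ?case using f(1)[of "Suc i"] f(3)[of i] by auto
  qed
  then have "(P * Z) $$ (i, j) = 0" if "r \<le> i" "i < n" "j < n" for i j
    using f(2)[of i j] that unfolding PQ(1)[symmetric] by simp
  moreover have fi: "f i < n" if "i < r" for i
    using min[OF that] f(1)[of i] by auto
  moreover have "(P * Z) $$ (k, f i) = (if k = i then 1 else 0)" if "i < r" "k < n" for i k
    using f(4)[of i] f(5)[of i k] fi[of i] that min[of i] unfolding PQ(1)[symmetric] by auto
  ultimately show ?thesis using PQ that by blast
qed

text \<open>Evaluating \<open>W Y = Y\<^sup>* W\<close> at an eigenvector \<open>u\<close> gives
  \<open>c d = cnj c * d\<close>, where \<open>d\<close> is the form of \<open>W\<close> at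
  \<open>u\<close>. Definiteness makes \<open>d\<close> nonzero, so \<open>c\<close> is
  real.\<close>

lemma selfadjoint_eigenvector:
  assumes W: "pos_definite n W" and Y: "Y \<in> carrier_mat n n" and WY: "W * Y = mat_adjoint Y * W"
    and n: "0 < n"
  obtains c u where "cnj c = c" "u \<in> carrier_vec n" "u \<noteq> 0\<^sub>v n" "Y *\<^sub>v u = c \<cdot>\<^sub>v u"
proof -
  obtain c where "c \<in> spectrum Y" using spectrum_non_empty[OF Y] n by blast
  then obtain u where u: "u \<in> carrier_vec n" "u \<noteq> 0\<^sub>v n" "Y *\<^sub>v u = c \<cdot>\<^sub>v u"
    using Y unfolding spectrum_def eigenvalue_def eigenvector_def by auto
  have Wc: "W \<in> carrier_mat n n" using W by (auto simp: pos_definite_def)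
  define d where "d = (W *\<^sub>v u) \<bullet>c u"
  have "d \<noteq> 0" using W u unfolding pos_definite_def d_def by force
  have "((W * Y) *\<^sub>v u) \<bullet>c u = c * d"
    using Wc Y u by (simp add: d_def assoc_mult_mat_vec[of _ n n _ n] mult_mat_vec)
  moreover have "((mat_adjoint Y * W) *\<^sub>v u) \<bullet>c u = cnj c * d"
  proof -
    have "((mat_adjoint Y * W) *\<^sub>v u) \<bullet>c u = (mat_adjoint Y *\<^sub>v (W *\<^sub>v u)) \<bullet>c u"
      using Wc Y u by (simp add: assoc_mult_mat_vec[of _ n n _ n])
    also have "\<dots> = (W *\<^sub>v u) \<bullet>c (Y *\<^sub>v u)"
      using Wc Y u(1) by (subst mult_mat_vec_cscalar_prod[of _ n n]) auto
    also have "\<dots> = cnj c * d"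
      using Wc u unfolding d_def by (simp add: conjugate_smult_vec)
    finally show ?thesis .
  qed
  ultimately have "c * d = cnj c * d" unfolding WY by (rule trans[OF sym])
  then have "cnj c = c" using \<open>d \<noteq> 0\<close> by auto
  then show ?thesis using u that by blast
qed

text \<open>The rows of \<open>M\<close> are the nonzero rows of the reduced row echelon form \<open>P Z\<^sup>*\<close> of \<open>Z\<^sup>*\<close>, with
  \<open>Z = Y - c\<close>, followed by those rows of \<open>P\<close> that annihilate \<open>Z\<^sup>*\<close>: bases of the row space and
  of the left kernel of \<open>Z\<^sup>*\<close>.\<close>

lemma ex_block_diagonalizing:
  assumes Wp: "pos_definite n W" and Y: "Y \<in> carrier_mat n n" and WY: "W * Y = mat_adjoint Y * W"
    and ns: "\<not> scalar_matrix n Y" and n: "0 < n"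
  obtains r M where "0 < r" "r < n" "M \<in> carrier_mat n n" "invertible_mat M"
    "\<And>V i j. V \<in> carrier_mat n n \<Longrightarrow> V * Y = mat_adjoint Y * V \<Longrightarrow> i < n \<Longrightarrow> j < n
       \<Longrightarrow> (i < r) \<noteq> (j < r) \<Longrightarrow> (M * V * mat_adjoint M) $$ (i, j) = 0"
proof -
  note assoc = assoc_mult_mat[of _ n n _ n _ n]
  obtain c u where c: "cnj c = c" and u: "u \<in> carrier_vec n" "u \<noteq> 0\<^sub>v n" "Y *\<^sub>v u = c \<cdot>\<^sub>v u"
    by (rule selfadjoint_eigenvector[OF Wp Y WY n])
  define Z where "Z = Y - c \<cdot>\<^sub>m 1\<^sub>m n"
  have Z: "Z \<in> carrier_mat n n" and Z': "mat_adjoint Z \<in> carrier_mat n n" using Y by (auto simp: Z_def)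
  \<comment> \<open>Since \<open>c\<close> is real, \<open>Z\<^sup>*\<close> is the same shift of
    \<open>Y\<^sup>*\<close>, so \<open>Z\<close> inherits the intertwining relation of
    \<open>Y\<close>.\<close>
  have adjZ: "mat_adjoint Z = mat_adjoint Y - c \<cdot>\<^sub>m 1\<^sub>m n"
    using Y c by (simp add: Z_def mat_adjoint_minus[of _ n n] mat_adjoint_smult)
  have VZ: "V * Z = mat_adjoint Z * V" if V: "V \<in> carrier_mat n n" and "V * Y = mat_adjoint Y * V" for V
  proof -
    have "V * Z = V * Y - c \<cdot>\<^sub>m V"
      unfolding Z_def using V Y by (simp add: mult_minus_distrib_mat[of _ n n _ n] mult_smult_distrib[of _ n n _ n])
    moreover have "mat_adjoint Z * V = mat_adjoint Y * V - c \<cdot>\<^sub>m V"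
      unfolding adjZ using V Y by (simp add: minus_mult_distrib_mat[of _ n n _ _ n] mult_smult_assoc_mat[of _ n n _ n])
    ultimately show ?thesis using that by simp
  qed
  obtain r f P Q where r: "r \<le> n" and P: "P \<in> carrier_mat n n" and Q: "Q \<in> carrier_mat n n" "P * Q = 1\<^sub>m n"
    and E0: "\<And>i j. r \<le> i \<Longrightarrow> i < n \<Longrightarrow> j < n \<Longrightarrow> (P * mat_adjoint Z) $$ (i, j) = 0"
    and f: "\<And>i. i < r \<Longrightarrow> f i < n"
    and E1: "\<And>i k. i < r \<Longrightarrow> k < n \<Longrightarrow> (P * mat_adjoint Z) $$ (k, f i) = (if k = i then 1 else 0)"
    by (rule reduced_row_echelon[OF Z']) blast
  define E where "E = P * mat_adjoint Z"
  have E: "E \<in> carrier_mat n n" using P Z' by (auto simp: E_def)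
  \<comment> \<open>With \<open>E = P Z\<^sup>*\<close>, the factor \<open>Z\<close> passes across
    \<open>V\<close> and attaches to the other \<open>P\<close>. The left side vanishes in columns
    from \<open>r\<close> on, the right side in rows from \<open>r\<close> on.\<close>
  have PZ: "P * V * mat_adjoint E = E * V * mat_adjoint P"
    if "V \<in> carrier_mat n n" "V * Y = mat_adjoint Y * V" for V
  proof -
    have "P * V * mat_adjoint E = P * (V * Z) * mat_adjoint P"
      unfolding E_def using P Z that(1) by (simp add: mat_adjoint_mult[of _ n n _ n] assoc)
    then show ?thesis unfolding VZ[OF that] E_def using P Z that(1) by (simp add: assoc)
  qed
  \<comment> \<open>The pivot columns of \<open>E\<close> are unit vectors, so column
    \<open>f j\<close> of \<open>C * E\<close> is column \<open>j\<close> of \<open>C\<close>: the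
    first \<open>r\<close> rows of \<open>E\<close> are independent.\<close>
  have cancel: "C = 0\<^sub>m n n"
    if C: "C \<in> carrier_mat n n" and "C * E = 0\<^sub>m n n" and C0: "\<And>i j. i < n \<Longrightarrow> r \<le> j \<Longrightarrow> j < n \<Longrightarrow> C $$ (i, j) = 0"
    for C
  proof (rule eq_matI)
    fix i j assume "i < dim_row (0\<^sub>m n n :: complex mat)" "j < dim_col (0\<^sub>m n n :: complex mat)"
    then have ij: "i < n" "j < n" by auto
    show "C $$ (i, j) = 0\<^sub>m n n $$ (i, j)"
    proof (cases "j < r")
      case True
      have "0 = (C * E) $$ (i, f j)" using that(2) ij f[OF True] by simp
      also have "\<dots> = (\<Sum>k<n. C $$ (i, k) * E $$ (k, f j))"
        using ij C E f[OF True] by (simp add: scalar_prod_def lessThan_atLeast0)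
      also have "\<dots> = (\<Sum>k<n. if k = j then C $$ (i, k) else 0)"
        using E1[OF True] unfolding E_def[symmetric] by (intro sum.cong) auto
      finally show ?thesis using ij by (simp add: sum.delta)
    next
      case False
      then show ?thesis using C0 ij by simp
    qed
  qed (use C in auto)
  \<comment> \<open>Without a pivot \<open>Z\<close> would be zero and \<open>Y\<close>
    scalar.\<close>
  have "0 < r"
  proof (rule ccontr)
    assume "\<not> 0 < r"
    then have "E = 0\<^sub>m n n" using E0 E unfolding E_def by (intro eq_matI) auto
    have QP: "Q * P = 1\<^sub>m n" using mat_mult_left_right_inverse[OF P Q] .
    have "mat_adjoint Z = Q * E"
      unfolding E_def using P Q QP Z by (simp add: assoc[symmetric])
    then have "mat_adjoint (mat_adjoint Z) = 0\<^sub>m n n" using Q \<open>E = 0\<^sub>m n n\<close> by simp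
    then have "Y = c \<cdot>\<^sub>m 1\<^sub>m n"
    proof (intro eq_matI)
      fix i j assume *: "i < dim_row (c \<cdot>\<^sub>m 1\<^sub>m n)" "j < dim_col (c \<cdot>\<^sub>m 1\<^sub>m n)"
      assume "mat_adjoint (mat_adjoint Z) = 0\<^sub>m n n"
      then have "Z $$ (i, j) = 0" using * by simp
      then show "Y $$ (i, j) = (c \<cdot>\<^sub>m 1\<^sub>m n) $$ (i, j)" using * Y by (simp add: Z_def)
    qed (use Y in auto)
    then show False using ns by (auto simp: scalar_matrix_def)
  qed
  moreover have "r < n"
  proof (rule ccontr)
    assume "\<not> r < n"
    then have "r = n" using r by simp
    \<comment> \<open>Every row of \<open>D\<close> is the conjugate of the eigenvector
      \<open>u\<close>, so \<open>Z u = 0\<close> becomes \<open>D Z\<^sup>* = 0\<close>. If all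
      rows of \<open>E\<close> had pivots, cancellation would give \<open>D = 0\<close>.\<close>
    define D where "D = mat n n (\<lambda>(i, j). cnj (vec_index u j))"
    have D: "D \<in> carrier_mat n n" by (simp add: D_def)
    have QP: "Q * P = 1\<^sub>m n" using mat_mult_left_right_inverse[OF P Q] .
    have "D * mat_adjoint Z = 0\<^sub>m n n"
    proof (rule eq_matI)
      fix i j assume "i < dim_row (0\<^sub>m n n :: complex mat)" "j < dim_col (0\<^sub>m n n :: complex mat)"
      then have ij: "i < n" "j < n" by auto
      have "Z *\<^sub>v u = 0\<^sub>v n"
      proof -
        have "(c \<cdot>\<^sub>m 1\<^sub>m n) *\<^sub>v u = c \<cdot>\<^sub>v u"
          using u(1) by (intro eq_vecI) auto
        then show ?thesis
          unfolding Z_def using Y u by (simp add: minus_mult_distrib_mat_vec[of _ n n])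
      qed
      then have "0 = cnj (vec_index (Z *\<^sub>v u) j)" using ij by simp
      also have "\<dots> = (D * mat_adjoint Z) $$ (i, j)"
        using ij Z u by (simp add: D_def scalar_prod_def mult.commute)
      finally show "(D * mat_adjoint Z) $$ (i, j) = 0\<^sub>m n n $$ (i, j)" using ij by simp
    qed (use D Z in auto)
    moreover have "D * Q * E = D * (Q * P) * mat_adjoint Z"
      unfolding E_def using D Q P Z' by (simp add: assoc)
    ultimately have "D * Q * E = 0\<^sub>m n n" using QP D by simp
    then have "D * Q = 0\<^sub>m n n" using D Q \<open>r = n\<close> by (intro cancel[of "D * Q"]) auto
    then have "D * (Q * P) = 0\<^sub>m n n" using D Q P by (simp add: assoc[symmetric])
    then have "D = 0\<^sub>m n n" using QP D by simp
    have "u = 0\<^sub>v n"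
    proof (rule eq_vecI)
      fix j assume "j < dim_vec (0\<^sub>v n :: complex Matrix.vec)"
      then have j: "j < n" by simp
      have "D $$ (j, j) = 0" using j \<open>D = 0\<^sub>m n n\<close> by simp
      then show "vec_index u j = vec_index (0\<^sub>v n) j" using j by (simp add: D_def)
    qed (use u in auto)
    then show False using u by simp
  qed
  moreover define M where "M = mat n n (\<lambda>(i, j). if i < r then E $$ (i, j) else P $$ (i, j))"
  have M: "M \<in> carrier_mat n n" by (simp add: M_def)
  moreover have "(M * V * mat_adjoint M) $$ (i, j) = 0"
    if V: "V \<in> carrier_mat n n" "V * Y = mat_adjoint Y * V" and ij: "i < n" "j < n" "(i < r) \<noteq> (j < r)" for V i j
  proof -
    have 1: "(E * V * mat_adjoint P) $$ (i, j) = 0" if "r \<le> i"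
      using ij that E0 unfolding E_def[symmetric]
      by (subst mat_sandwich_index[OF E V(1) P]) auto
    have 2: "(P * V * mat_adjoint E) $$ (i, j) = 0" if "r \<le> j"
      using ij that E0 unfolding E_def[symmetric]
      by (subst mat_sandwich_index[OF P V(1) E]) auto
    show ?thesis
    proof (cases "i < r")
      case True
      have "(M * V * mat_adjoint M) $$ (i, j) = (E * V * mat_adjoint P) $$ (i, j)"
        unfolding mat_sandwich_index[OF M V(1) M ij(1,2)] mat_sandwich_index[OF E V(1) P ij(1,2)]
        using True ij by (intro sum.cong) (auto simp: M_def)
      then show ?thesis using 2 True ij PZ[OF V] by simp
    next
      case False
      have "(M * V * mat_adjoint M) $$ (i, j) = (P * V * mat_adjoint E) $$ (i, j)"
        unfolding mat_sandwich_index[OF M V(1) M ij(1,2)] mat_sandwich_index[OF P V(1) E ij(1,2)]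
        using False ij by (intro sum.cong) (auto simp: M_def)
      then show ?thesis using 1 False PZ[OF V] by simp
    qed
  qed
  moreover have "invertible_mat M"
  proof (rule invertible_matI_left_cancel[OF M])
    fix C assume C: "C \<in> carrier_mat n n" and CM: "C * M = 0\<^sub>m n n"
    \<comment> \<open>The rows of \<open>C1 E\<close> lie in the row space of
      \<open>Z\<^sup>*\<close>, those of \<open>G = C2 P\<close> in its left kernel. These spaces
      are orthogonal for \<open>W\<close>, so \<open>C1 E + G = 0\<close> makes \<open>G\<close>
      orthogonal to itself.\<close>
    define C1 where "C1 = mat n n (\<lambda>(i, j). if j < r then C $$ (i, j) else 0)"
    define C2 where "C2 = mat n n (\<lambda>(i, j). if j < r then 0 else C $$ (i, j))"
    have C1: "C1 \<in> carrier_mat n n" and C2: "C2 \<in> carrier_mat n n" by (auto simp: C1_def C2_def)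
    define G where "G = C2 * P"
    have G: "G \<in> carrier_mat n n" using C2 P by (simp add: G_def)
    have "C * M = C1 * E + G"
      unfolding G_def
    proof (rule eq_matI)
      fix i j assume "i < dim_row (C1 * E + C2 * P)" "j < dim_col (C1 * E + C2 * P)"
      then have ij: "i < n" "j < n" using C2 P by auto
      have "(C * M) $$ (i, j) = (\<Sum>k<n. C $$ (i, k) * M $$ (k, j))"
        using ij C M by (simp add: scalar_prod_def lessThan_atLeast0)
      also have "\<dots> = (\<Sum>k<n. C1 $$ (i, k) * E $$ (k, j) + C2 $$ (i, k) * P $$ (k, j))"
        using ij by (intro sum.cong) (auto simp: C1_def C2_def M_def)
      also have "\<dots> = (C1 * E + C2 * P) $$ (i, j)"
        using ij C1 C2 E P by (simp add: scalar_prod_def lessThan_atLeast0 sum.distrib)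
      finally show "(C * M) $$ (i, j) = (C1 * E + C2 * P) $$ (i, j)" .
    qed (use C M C2 P in auto)
    then have sum0: "C1 * E + G = 0\<^sub>m n n" using CM by simp
    have GE: "G = - (C1 * E)"
    proof (rule eq_matI)
      fix i j assume *: "i < dim_row (- (C1 * E))" "j < dim_col (- (C1 * E))"
      have "(C1 * E + G) $$ (i, j) = 0" unfolding sum0 using * C1 E by simp
      then show "G $$ (i, j) = (- (C1 * E)) $$ (i, j)" using * C1 E G by (simp add: add_eq_0_iff)
    qed (use C1 E G in auto)
    have "G * mat_adjoint Z = C2 * E" unfolding G_def E_def using C2 P Z by (simp add: assoc)
    also have "\<dots> = 0\<^sub>m n n"
    proof (rule eq_matI)
      fix i j assume "i < dim_row (0\<^sub>m n n :: complex mat)" "j < dim_col (0\<^sub>m n n :: complex mat)"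
      then have ij: "i < n" "j < n" by auto
      have "(C2 * E) $$ (i, j) = (\<Sum>k<n. C2 $$ (i, k) * E $$ (k, j))"
        using ij C2 E by (simp add: scalar_prod_def lessThan_atLeast0)
      also have "\<dots> = 0"
        using ij E0 unfolding E_def[symmetric] C2_def by (intro sum.neutral) auto
      finally show "(C2 * E) $$ (i, j) = 0\<^sub>m n n $$ (i, j)" using ij by simp
    qed (use C2 E in auto)
    finally have GZ: "G * mat_adjoint Z = 0\<^sub>m n n" .
    have Wc: "W \<in> carrier_mat n n" using Wp by (simp add: pos_definite_def)
    have "Z * mat_adjoint G = mat_adjoint (G * mat_adjoint Z)"
      using G Z by (simp add: mat_adjoint_mult[of _ n n _ n])
    then have ZG: "Z * mat_adjoint G = 0\<^sub>m n n" unfolding GZ by simp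
    have ZW: "mat_adjoint Z * W \<in> carrier_mat n n" using Z' Wc by (rule mult_carrier_mat)
    \<comment> \<open>The orthogonality: \<open>Z\<^sup>*\<close> inside \<open>E\<close> crosses
      \<open>W\<close> as \<open>Z\<close> and meets \<open>Z G\<^sup>* = 0\<close>.\<close>
    have "C1 * E * W * mat_adjoint G = C1 * P * (mat_adjoint Z * W) * mat_adjoint G"
      unfolding E_def using C1 P Z Z' Wc ZW mat_adjoint_carrier[OF G] by (simp add: assoc)
    also have "\<dots> = C1 * P * W * (Z * mat_adjoint G)"
      unfolding VZ[OF Wc WY, symmetric] using C1 P Z Z' Wc ZW mat_adjoint_carrier[OF G] by (simp add: assoc)
    also have "\<dots> = 0\<^sub>m n n" unfolding ZG using C1 P Wc by (intro right_mult_zero_mat) simp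
    finally have "C1 * E * W * mat_adjoint G = 0\<^sub>m n n" .
    moreover have "- 0\<^sub>m n n = (0\<^sub>m n n :: complex mat)" by (intro eq_matI) auto
    ultimately have "G * W * mat_adjoint G = 0\<^sub>m n n"
      using C1 E Wc G GE by (simp add: uminus_mult_left_mat)
    then have G0: "G = 0\<^sub>m n n" by (intro pos_definite_eq_zero[OF Wp G]) simp
    have "C2 * (P * Q) = G * Q" unfolding G_def using C2 P Q by (simp add: assoc)
    then have "C2 = 0\<^sub>m n n" using C2 Q G0 by simp
    moreover have "C1 = 0\<^sub>m n n"
    proof (rule cancel[OF C1])
      show "C1 * E = 0\<^sub>m n n" using sum0 C1 E unfolding G0 by simp
    qed (simp add: C1_def)
    moreover have "C = C1 + C2" using C by (intro eq_matI) (auto simp: C1_def C2_def)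
    ultimately show "C = 0\<^sub>m n n" by simp
  qed
  ultimately show ?thesis using that by blast
qed

section \<open>Determinacy of the moment problem on a bounded interval\<close>

text \<open>On the compact set carrying \<open>g\<close> the continuous factor is bounded, so a
  multiple of \<open>g\<close> dominates.\<close>

lemma integrable_continuous_mult_bounded_support:
  fixes g h :: "real \<Rightarrow> real"
  assumes g: "integrable lborel g" and supp: "\<And>x. x \<notin> {c..d} \<Longrightarrow> g x = 0"
    and h: "continuous_on UNIV h"
  shows "integrable lborel (\<lambda>x. h x * g x)"
proof -
  have "compact (h ` {c..d})"
    by (intro compact_continuous_image continuous_on_subset[OF h]) auto
  then obtain B where B: "\<And>x. x \<in> {c..d} \<Longrightarrow> \<bar>h x\<bar> \<le> B"
    using compact_imp_bounded[of "h ` {c..d}"] unfolding bounded_iff by (metis imageI real_norm_def)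
  show ?thesis
  proof (rule Bochner_Integration.integrable_bound)
    show "integrable lborel (\<lambda>x. B * g x)" using g by simp
    show "(\<lambda>x. h x * g x) \<in> borel_measurable lborel"
      using g borel_measurable_continuous_onI[OF h] by auto
    show "AE x in lborel. norm (h x * g x) \<le> norm (B * g x)"
    proof (intro AE_I2)
      fix x show "norm (h x * g x) \<le> norm (B * g x)"
      proof (cases "x \<in> {c..d}")
        case True
        then show ?thesis using B[of x] by (auto simp: abs_mult intro!: mult_right_mono)
      next
        case False
        then show ?thesis using supp[of x] by simp
      qed
    qed
  qed
qed

text \<open>By Weierstrass, \<open>h\<close> is uniformly close on \<open>{c..d}\<close> to a
  polynomial, whose integral against \<open>g\<close> vanishes. The error is at most the uniform
  distance times the integral of the absolute value of \<open>g\<close>.\<close>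

lemma integral_continuous_eq_zero_if_moments_zero:
  fixes g h :: "real \<Rightarrow> real"
  assumes g: "integrable lborel g" and supp: "\<And>x. x \<notin> {c..d} \<Longrightarrow> g x = 0"
    and mom: "\<And>n. (\<integral>x. x ^ n * g x \<partial>lborel) = 0"
    and h: "continuous_on UNIV h"
  shows "(\<integral>x. h x * g x \<partial>lborel) = 0"
proof -
  have int: "integrable lborel (\<lambda>x. k x * g x)" if "continuous_on UNIV k" for k
    by (rule integrable_continuous_mult_bounded_support[OF g supp that])
  define I where "I = (\<integral>x. \<bar>g x\<bar> \<partial>lborel)"
  have "I \<ge> 0" unfolding I_def by simp
  have "\<bar>\<integral>x. h x * g x \<partial>lborel\<bar> \<le> e" if "e > 0" for e
  proof -
    \<comment> \<open>The summand 1 keeps the denominator positive when \<open>g\<close> vanishes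
      almost everywhere.\<close>
    define e' where "e' = e / (I + 1)"
    have "e' > 0" using \<open>e > 0\<close> \<open>I \<ge> 0\<close> by (simp add: e'_def)
    then obtain p where p: "real_polynomial_function p" "\<And>x. x \<in> {c..d} \<Longrightarrow> \<bar>h x - p x\<bar> < e'"
      using Stone_Weierstrass_real_polynomial_function[of "{c..d}" h e'] continuous_on_subset[OF h] by auto
    from p(1) obtain a m where pa: "p = (\<lambda>x. \<Sum>i\<le>m. a i * x ^ i)"
      unfolding real_polynomial_function_iff_sum by blast
    have pc: "continuous_on UNIV p" unfolding pa by (intro continuous_intros)
    have "(\<integral>x. p x * g x \<partial>lborel) = (\<integral>x. (\<Sum>i\<le>m. a i * (x ^ i * g x)) \<partial>lborel)"
      unfolding pa by (simp add: sum_distrib_right mult.assoc)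
    also have "\<dots> = (\<Sum>i\<le>m. a i * (\<integral>x. x ^ i * g x \<partial>lborel))"
      by (subst Bochner_Integration.integral_sum) (auto intro!: int continuous_intros)
    finally have "(\<integral>x. p x * g x \<partial>lborel) = 0" using mom by simp
    then have "(\<integral>x. h x * g x \<partial>lborel) = (\<integral>x. h x * g x - p x * g x \<partial>lborel)"
      using int[OF h] int[OF pc] by simp
    also have "\<bar>\<dots>\<bar> \<le> (\<integral>x. e' * \<bar>g x\<bar> \<partial>lborel)"
    proof (rule order_trans[OF integral_abs_bound], rule integral_mono)
      show "integrable lborel (\<lambda>x. \<bar>h x * g x - p x * g x\<bar>)"
        using int[OF h] int[OF pc] by auto
      show "integrable lborel (\<lambda>x. e' * \<bar>g x\<bar>)" using g by auto
      fix x :: real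
      show "\<bar>h x * g x - p x * g x\<bar> \<le> e' * \<bar>g x\<bar>"
      proof (cases "x \<in> {c..d}")
        case True
        then show ?thesis using p(2)[of x]
          by (simp add: left_diff_distrib[symmetric] abs_mult mult_right_mono)
      next
        case False
        then show ?thesis using supp[of x] by simp
      qed
    qed
    also have "\<dots> = e' * I" by (simp add: I_def)
    also have "\<dots> \<le> e" using \<open>e > 0\<close> \<open>I \<ge> 0\<close> by (simp add: e'_def field_simps)
    finally show ?thesis .
  qed
  then show ?thesis using field_le_epsilon[of "\<bar>\<integral>x. h x * g x \<partial>lborel\<bar>" 0] by simp
qed

text \<open>Continuous ramps approximate indicators of open rays, so \<open>g\<close> integrates to
  zero over every ray. Rays are an intersection-stable generator of the Borel sets, which extends
  this to all Borel sets and forces \<open>g = 0\<close> almost everywhere.\<close>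

lemma moments_zero_imp_AE_zero_lborel:
  fixes g :: "real \<Rightarrow> real"
  assumes g: "integrable lborel g" and supp: "\<And>x. x \<notin> {c..d} \<Longrightarrow> g x = 0"
    and mom: "\<And>n. (\<integral>x. x ^ n * g x \<partial>lborel) = 0"
  shows "AE x in lborel. g x = 0"
proof -
  have [measurable]: "g \<in> borel_measurable borel" using g by auto
  have ray: "(LINT x:{t<..}|lborel. g x) = 0" for t
  proof -
    \<comment> \<open>For positive \<open>n\<close> this ramp rises linearly from 0 at
      \<open>t\<close> to 1 at \<open>t + 1/n\<close>. At \<open>t\<close> itself it stays 0,
      matching the open ray.\<close>
    define h where "h n x = min 1 (max 0 (real n * (x - t)))" for n x
    have "(\<lambda>n. \<integral>x. h n x * g x \<partial>lborel) \<longlonglongrightarrow> (\<integral>x. indicator {t<..} x * g x \<partial>lborel)"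
    proof (rule integral_dominated_convergence[where w = "\<lambda>x. \<bar>g x\<bar>"])
      show "AE x in lborel. (\<lambda>n. h n x * g x) \<longlonglongrightarrow> indicator {t<..} x * g x"
      proof (intro AE_I2 tendsto_mult tendsto_const)
        fix x
        show "(\<lambda>n. h n x) \<longlonglongrightarrow> indicator {t<..} x"
        proof (cases "x > t")
          case True
          obtain m :: nat where m: "1 / (x - t) \<le> real m" using real_arch_simple by blast
          have "h n x = 1" if "n \<ge> m" for n
          proof -
            have "1 / (x - t) \<le> real n" using m that by linarith
            then show ?thesis using True by (simp add: h_def field_simps)
          qed
          then have "\<forall>\<^sub>F n in sequentially. h n x = 1" by (auto simp: eventually_sequentially)
          then show ?thesis using True by (simp add: tendsto_eventually)
        next
          case False
          then have "real n * (x - t) \<le> 0" for n by (simp add: mult_le_0_iff)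
          then have "h n x = 0" for n by (simp add: h_def max_absorb1)
          then show ?thesis using False by simp
        qed
      qed
      show "AE x in lborel. norm (h n x * g x) \<le> \<bar>g x\<bar>" for n
        by (intro AE_I2) (auto simp: abs_mult h_def intro!: mult_left_le_one_le)
    qed (use g in \<open>auto simp: h_def\<close>)
    moreover have "(\<integral>x. h n x * g x \<partial>lborel) = 0" for n
      by (rule integral_continuous_eq_zero_if_moments_zero[OF g supp mom])
         (auto simp: h_def intro!: continuous_intros)
    ultimately show ?thesis
      unfolding set_lebesgue_integral_def by (simp add: LIMSEQ_const_iff)
  qed
  have borel_greaterThan: "sets borel = sigma_sets UNIV (range (greaterThan :: real \<Rightarrow> _))"
    by (subst borel_Ioi) auto
  have whole: "(\<integral>x. g x \<partial>lborel) = 0" using mom[of 0] by simp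
  have si: "set_integrable lborel A g" if "A \<in> sets borel" for A
    using g that unfolding set_integrable_def by (intro integrable_mult_indicator) auto
  have "(LINT x:A|lborel. g x) = 0" if A: "A \<in> sigma_sets UNIV (range greaterThan)" for A
  proof -
    have "{a<..} \<inter> {b<..} = {max a b<..}" for a b :: real by auto
    then have "Int_stable (range (greaterThan :: real \<Rightarrow> _))" by (auto simp: Int_stable_def)
    moreover have "range (greaterThan :: real \<Rightarrow> _) \<subseteq> Pow UNIV" by simp
    ultimately show ?thesis using A
    proof (induction rule: sigma_sets_induct_disjoint)
      fix A assume "A \<in> range (greaterThan :: real \<Rightarrow> _)"
      then show "(LINT x:A|lborel. g x) = 0" using ray by auto
    next
      show "(LINT x:{}|lborel. g x) = 0" by (simp add: set_lebesgue_integral_def)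
    next
      fix A assume A: "A \<in> sigma_sets UNIV (range (greaterThan :: real \<Rightarrow> _))" "(LINT x:A|lborel. g x) = 0"
      then have m: "A \<in> sets borel" by (simp add: borel_greaterThan)
      have "(LINT x:A \<union> (UNIV - A)|lborel. g x) = (LINT x:A|lborel. g x) + (LINT x:UNIV - A|lborel. g x)"
        by (rule set_integral_Un) (use si m in auto)
      then show "(LINT x:UNIV - A|lborel. g x) = 0"
        using A(2) whole by (simp add: set_lebesgue_integral_def)
    next
      fix A :: "nat \<Rightarrow> real set"
      assume A: "disjoint_family A" "range A \<subseteq> sigma_sets UNIV (range greaterThan)"
        "\<And>i. (LINT x:A i|lborel. g x) = 0"
      have m: "A i \<in> sets borel" for i using A(2) by (auto simp: borel_greaterThan)
      have "(LINT x:(\<Union>i. A i)|lborel. g x) = (\<Sum>i. (LINT x:A i|lborel. g x))"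
        by (rule lebesgue_integral_countable_add)
           (use A m si in \<open>auto simp: disjoint_family_on_def\<close>)
      then show "(LINT x:(\<Union>i. A i)|lborel. g x) = 0" using A(3) by simp
    qed
  qed
  then have "(LINT x:A|lborel. g x) = (LINT x:A|lborel. 0)" if "A \<in> sets lborel" for A
    using that by (simp add: borel_greaterThan set_lebesgue_integral_def)
  then show ?thesis by (intro density_unique_real) (use g in auto)
qed

text \<open>A Lebesgue measurable function agrees almost everywhere with a Borel one, which reduces
  the claim to \<open>lborel\<close>.\<close>

lemma moments_zero_imp_AE_zero_real:
  fixes f :: "real \<Rightarrow> real"
  assumes f: "integrable lebesgue f" and supp: "\<And>x. x \<notin> {c..d} \<Longrightarrow> f x = 0"
    and mom: "\<And>n. (\<integral>x. x ^ n * f x \<partial>lebesgue) = 0"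
  shows "AE x in lebesgue. f x = 0"
proof -
  obtain g0 where g0: "g0 \<in> borel_measurable lborel" "AE x in lborel. f x = g0 x"
    using completion_ex_borel_measurable_real[of f lborel] f by auto
  \<comment> \<open>The Borel representative may differ from zero on a null set outside
    \<open>{c..d}\<close>; the cutoff restores the support condition at every point.\<close>
  define g where "g x = indicator {c..d} x * g0 x" for x
  have gm: "g \<in> borel_measurable lborel" using g0(1) unfolding g_def by measurable
  have ae: "AE x in lborel. f x = g x"
    using g0(2)
  proof eventually_elim
    case (elim x)
    then show ?case using supp[of x] by (auto simp: g_def indicator_def)
  qed
  then have ae': "AE x in lebesgue. f x = g x" by (rule AE_completion)
  have "integrable lebesgue g"
    by (rule integrable_cong_AE_imp[OF f]) (use gm ae' in \<open>auto simp: measurable_completion\<close>)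
  then have gi: "integrable lborel g" using gm by (simp add: integrable_completion)
  have "(\<integral>x. x ^ n * g x \<partial>lborel) = 0" for n
  proof -
    have "(\<integral>x. x ^ n * g x \<partial>lborel) = (\<integral>x. x ^ n * g x \<partial>lebesgue)"
      using gm by (intro integral_completion[symmetric]) auto
    also have "\<dots> = (\<integral>x. x ^ n * f x \<partial>lebesgue)"
      by (rule integral_cong_AE) (use ae' gm f in \<open>auto intro!: borel_measurable_times simp: measurable_completion\<close>)
    finally show ?thesis using mom by simp
  qed
  then have "AE x in lborel. g x = 0"
    by (intro moments_zero_imp_AE_zero_lborel[OF gi, of c d]) (auto simp: g_def)
  then have "AE x in lebesgue. g x = 0" by (rule AE_completion)
  with ae' show ?thesis by eventually_elim simp
qed

lemma moments_zero_imp_AE_zero: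
  fixes f :: "real \<Rightarrow> complex"
  assumes f: "\<And>n. integrable lebesgue (\<lambda>x. of_real (x ^ n) * f x)" and supp: "\<And>x. x \<notin> {c..d} \<Longrightarrow> f x = 0"
    and mom: "\<And>n. (\<integral>x. of_real (x ^ n) * f x \<partial>lebesgue) = 0"
  shows "AE x in lebesgue. f x = 0"
proof -
  have f0: "integrable lebesgue f" using f[of 0] by simp
  have "(\<integral>x. x ^ n * Re (f x) \<partial>lebesgue) = 0" "(\<integral>x. x ^ n * Im (f x) \<partial>lebesgue) = 0" for n
    using integral_Re[OF f[of n]] integral_Im[OF f[of n]] unfolding mom by auto
  then have "AE x in lebesgue. Re (f x) = 0" "AE x in lebesgue. Im (f x) = 0"
    using f0 supp by (auto intro!: moments_zero_imp_AE_zero_real[of _ c d])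
  then show ?thesis by eventually_elim (simp add: complex_eq_iff)
qed

section \<open>Matrix polynomials\<close>

definition const_mpoly :: "complex mat \<Rightarrow> complex poly mat" where
  "const_mpoly C = map_mat (\<lambda>c. [:c:]) C"

lemma const_mpoly_carrier [simp]: "const_mpoly C \<in> carrier_mat n m \<longleftrightarrow> C \<in> carrier_mat n m"
  by (simp add: const_mpoly_def)

lemma const_mpoly_mult:
  assumes "A \<in> carrier_mat n m" "B \<in> carrier_mat m l"
  shows "const_mpoly (A * B) = const_mpoly A * const_mpoly B"
  using assms unfolding const_mpoly_def
  by (intro eq_matI) (auto simp: scalar_prod_def poly_eq_iff coeff_sum coeff_pCons mult.commute split: nat.splits intro!: sum.cong)

lemma mpoly_coeff_carrier [simp]: "mpoly_coeff P k \<in> carrier_mat n m \<longleftrightarrow> P \<in> carrier_mat n m"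
  by (simp add: mpoly_coeff_def)

lemma mpoly_coeff_dim [simp]:
  "dim_row (mpoly_coeff P k) = dim_row P" "dim_col (mpoly_coeff P k) = dim_col P"
  by (simp_all add: mpoly_coeff_def)

lemma mpoly_eval_carrier [simp]: "mpoly_eval P x \<in> carrier_mat n m \<longleftrightarrow> P \<in> carrier_mat n m"
  by (simp add: mpoly_eval_def)

lemma mpoly_coeff_const_mult:
  assumes "C \<in> carrier_mat n m" "P \<in> carrier_mat m l"
  shows "mpoly_coeff (const_mpoly C * P) k = C * mpoly_coeff P k"
  using assms unfolding mpoly_coeff_def const_mpoly_def
  by (intro eq_matI) (auto simp: scalar_prod_def coeff_sum intro!: sum.cong)

lemma mpoly_coeff_mult_const:
  assumes "P \<in> carrier_mat n m" "C \<in> carrier_mat m l"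
  shows "mpoly_coeff (P * const_mpoly C) k = mpoly_coeff P k * C"
  using assms unfolding mpoly_coeff_def const_mpoly_def
  by (intro eq_matI) (auto simp: scalar_prod_def coeff_sum mult.commute intro!: sum.cong)

lemma mpoly_coeff_add:
  assumes "P \<in> carrier_mat n m" "Q \<in> carrier_mat n m"
  shows "mpoly_coeff (P + Q) k = mpoly_coeff P k + mpoly_coeff Q k"
  using assms unfolding mpoly_coeff_def by (intro eq_matI) auto

lemma mpoly_coeff_minus:
  assumes "P \<in> carrier_mat n m" "Q \<in> carrier_mat n m"
  shows "mpoly_coeff (P - Q) k = mpoly_coeff P k - mpoly_coeff Q k"
  using assms unfolding mpoly_coeff_def by (intro eq_matI) auto

lemma mpoly_eval_mult:
  assumes "P \<in> carrier_mat n m" "Q \<in> carrier_mat m l"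
  shows "mpoly_eval (P * Q) x = mpoly_eval P x * mpoly_eval Q x"
  using assms unfolding mpoly_eval_def
  by (intro eq_matI) (auto simp: scalar_prod_def poly_sum intro!: sum.cong)

lemma mpoly_eval_add:
  assumes "P \<in> carrier_mat n m" "Q \<in> carrier_mat n m"
  shows "mpoly_eval (P + Q) x = mpoly_eval P x + mpoly_eval Q x"
  using assms unfolding mpoly_eval_def by (intro eq_matI) auto

lemma mpoly_eval_minus:
  assumes "P \<in> carrier_mat n m" "Q \<in> carrier_mat n m"
  shows "mpoly_eval (P - Q) x = mpoly_eval P x - mpoly_eval Q x"
  using assms unfolding mpoly_eval_def by (intro eq_matI) auto

lemma mpoly_eval_const [simp]: "mpoly_eval (const_mpoly C) x = C"
  unfolding mpoly_eval_def const_mpoly_def by (intro eq_matI) auto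

lemma mpoly_eval_smult:
  "mpoly_eval (p \<cdot>\<^sub>m P) x = poly p (of_real x) \<cdot>\<^sub>m mpoly_eval P x"
  unfolding mpoly_eval_def by (intro eq_matI) auto

lemma mpoly_eval_zero [simp]: "mpoly_eval (0\<^sub>m n m) x = 0\<^sub>m n m"
  unfolding mpoly_eval_def by (intro eq_matI) auto

lemma poly_zero_if_zero_on_infinite:
  fixes p :: "complex poly"
  assumes "\<And>x. x \<in> S \<Longrightarrow> poly p (of_real x) = 0" "infinite (S :: real set)"
  shows "p = 0"
proof (rule ccontr)
  assume "p \<noteq> 0"
  then have "finite {z. poly p z = 0}" by (rule poly_roots_finite)
  then have "finite (of_real ` S :: complex set)" by (rule rev_finite_subset) (use assms(1) in auto)
  then have "finite S" by (rule finite_imageD) (auto simp: inj_on_def)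
  then show False using assms(2) by simp
qed

text \<open>Entrywise, a nonzero polynomial has only finitely many roots. The set \<open>S\<close>
  will be either the whole line or a set of full measure in the interval.\<close>

lemma mpoly_eq_if_eval_eq:
  assumes P: "P \<in> carrier_mat n m" and Q: "Q \<in> carrier_mat n m"
    and eq: "\<And>x. x \<in> S \<Longrightarrow> mpoly_eval P x = mpoly_eval Q x" and S: "infinite S"
  shows "P = Q"
proof (rule eq_matI)
  fix i j assume "i < dim_row Q" "j < dim_col Q"
  then have ij: "i < n" "j < m" using Q by auto
  have "poly (P $$ (i, j) - Q $$ (i, j)) (of_real x) = 0" if "x \<in> S" for x
  proof -
    have "mpoly_eval P x $$ (i, j) = mpoly_eval Q x $$ (i, j)" using eq that by simp
    then show ?thesis using ij P Q by (simp add: mpoly_eval_def)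
  qed
  then show "P $$ (i, j) = Q $$ (i, j)"
    using poly_zero_if_zero_on_infinite[OF _ S, of "P $$ (i, j) - Q $$ (i, j)"] by simp
qed (use P Q in auto)

text \<open>The bound is strict so that \<open>n = 0\<close> leaves only the zero polynomial, which
  is the base case of the inductions on the degree.\<close>

definition mpoly_deg_less :: "nat \<Rightarrow> nat \<Rightarrow> complex poly mat \<Rightarrow> bool" where
  "mpoly_deg_less N n P \<longleftrightarrow> P \<in> carrier_mat N N \<and> (\<forall>k\<ge>n. mpoly_coeff P k = 0\<^sub>m N N)"

lemma mpoly_deg_less_0: "mpoly_deg_less N 0 P \<Longrightarrow> P = 0\<^sub>m N N"
proof (rule eq_matI)
  assume P: "mpoly_deg_less N 0 P"
  fix i j assume "i < dim_row (0\<^sub>m N N :: complex poly mat)" "j < dim_col (0\<^sub>m N N :: complex poly mat)"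
  then have ij: "i < N" "j < N" by auto
  show "P $$ (i, j) = 0\<^sub>m N N $$ (i, j)"
  proof (rule poly_eqI)
    fix k
    have "mpoly_coeff P k $$ (i, j) = 0" using P ij by (simp add: mpoly_deg_less_def)
    moreover have "P \<in> carrier_mat N N" using P by (simp add: mpoly_deg_less_def)
    ultimately show "coeff (P $$ (i, j)) k = coeff (0\<^sub>m N N $$ (i, j)) k"
      using ij by (simp add: mpoly_coeff_def)
  qed
qed (auto simp: mpoly_deg_less_def)

text \<open>The monic \<open>P\<close> cancels the leading term of \<open>G\<close> through a left
  multiple: this is the induction step of every expansion in the orthogonal polynomials.\<close>

lemma mpoly_deg_less_reduce:
  assumes G: "mpoly_deg_less N (Suc n) G" and P: "monic_mpoly N n P"
  shows "mpoly_deg_less N n (G - const_mpoly (mpoly_coeff G n) * P)"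
proof -
  have c: "G \<in> carrier_mat N N" "P \<in> carrier_mat N N" "mpoly_coeff G n \<in> carrier_mat N N"
    using G P by (auto simp: mpoly_deg_less_def monic_mpoly_def)
  have "mpoly_coeff (G - const_mpoly (mpoly_coeff G n) * P) k = 0\<^sub>m N N" if "n \<le> k" for k
  proof -
    have "mpoly_coeff (G - const_mpoly (mpoly_coeff G n) * P) k = mpoly_coeff G k - mpoly_coeff G n * mpoly_coeff P k"
      using c by (subst mpoly_coeff_minus[of _ N N]) (auto simp: mpoly_coeff_const_mult[of _ N N _ N])
    also have "\<dots> = 0\<^sub>m N N"
      using that G P c by (cases "k = n") (auto simp: mpoly_deg_less_def monic_mpoly_def)
    finally show ?thesis .
  qed
  then show ?thesis using c by (auto simp: mpoly_deg_less_def)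
qed

lemma monic_mpoly_0: "monic_mpoly N 0 P \<Longrightarrow> P = 1\<^sub>m N"
proof -
  assume P: "monic_mpoly N 0 P"
  have "mpoly_deg_less N 0 (P - 1\<^sub>m N)"
    unfolding mpoly_deg_less_def
  proof (intro conjI allI impI)
    fix k
    have one: "mpoly_coeff (1\<^sub>m N) k = (if k = 0 then 1\<^sub>m N else 0\<^sub>m N N)"
      by (intro eq_matI) (auto simp: mpoly_coeff_def coeff_eq_0)
    show "mpoly_coeff (P - 1\<^sub>m N) k = 0\<^sub>m N N"
      using P one by (subst mpoly_coeff_minus[of _ N N]) (auto simp: monic_mpoly_def)
  qed (use P in \<open>auto simp: monic_mpoly_def\<close>)
  then have *: "P - 1\<^sub>m N = 0\<^sub>m N N" by (rule mpoly_deg_less_0)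
  show "P = 1\<^sub>m N"
  proof (rule eq_matI)
    fix i j assume ij: "i < dim_row (1\<^sub>m N :: complex poly mat)" "j < dim_col (1\<^sub>m N :: complex poly mat)"
    have "(P - 1\<^sub>m N) $$ (i, j) = 0" unfolding * using ij by simp
    then show "P $$ (i, j) = 1\<^sub>m N $$ (i, j)" using ij P by (simp add: monic_mpoly_def)
  qed (use P in \<open>auto simp: monic_mpoly_def\<close>)
qed

section \<open>The inner product of a weight\<close>

lemma einterval_positive_measure:
  assumes "a < b"
  shows "\<not> (AE x in lebesgue. x \<notin> einterval a b)"
proof
  assume "AE x in lebesgue. x \<notin> einterval a b"
  obtain p :: real where p: "a < ereal p" "ereal p < b" using ereal_dense2[OF assms] by blast
  obtain q :: real where q: "ereal p < ereal q" "ereal q < b" using ereal_dense2[OF p(2)] by blast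
  have sub: "{p..q} \<subseteq> einterval a b"
  proof
    fix x assume "x \<in> {p..q}"
    then have "ereal p \<le> ereal x" "ereal x \<le> ereal q" by auto
    then show "x \<in> einterval a b"
      using less_le_trans[OF p(1), of "ereal x"] le_less_trans[OF _ q(2), of "ereal x"]
      by (simp add: einterval_def)
  qed
  have "AE x in lebesgue. x \<notin> {p..q}"
    using \<open>AE x in lebesgue. x \<notin> einterval a b\<close> by eventually_elim (use sub in auto)
  then have "emeasure lebesgue {p..q} = 0"
    by (subst (asm) AE_iff_measurable[of "{p..q}"]) auto
  then show False using q by simp
qed

text \<open>Finite sets are null, whereas the interval has positive measure. This serves both to
  identify polynomials that agree almost everywhere and to pick a single good point.\<close>

lemma AE_on_einterval_infinite:
  assumes "a < b" "AE x in lebesgue. x \<in> einterval a b \<longrightarrow> P x"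
  shows "infinite {x \<in> einterval a b. P x}"
proof
  assume "finite {x \<in> einterval a b. P x}"
  then have "{x \<in> einterval a b. P x} \<in> null_sets lebesgue"
    by (intro null_sets_completionI finite_imp_null_set_lborel)
  then have "AE x in lebesgue. x \<notin> {x \<in> einterval a b. P x}" by (rule AE_not_in)
  with assms(2) have "AE x in lebesgue. x \<notin> einterval a b" by eventually_elim auto
  then show False using einterval_positive_measure[OF assms(1)] by simp
qed

section \<open>Entrywise integration of matrix functions\<close>

lemma set_integrable_sum:
  fixes f :: "'i \<Rightarrow> 'a \<Rightarrow> 'b :: {banach, second_countable_topology}"
  assumes "\<And>i. i \<in> I \<Longrightarrow> set_integrable M A (f i)"
  shows "set_integrable M A (\<lambda>x. \<Sum>i\<in>I. f i x)"
  using assms unfolding set_integrable_def by (simp add: scaleR_sum_right)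

lemma set_integral_sum:
  fixes f :: "'i \<Rightarrow> 'a \<Rightarrow> 'b :: {banach, second_countable_topology}"
  assumes "\<And>i. i \<in> I \<Longrightarrow> set_integrable M A (f i)"
  shows "(LINT x:A|M. \<Sum>i\<in>I. f i x) = (\<Sum>i\<in>I. LINT x:A|M. f i x)"
  using assms unfolding set_integrable_def set_lebesgue_integral_def
  by (simp add: scaleR_sum_right)

lemma mat_integral_carrier [simp]: "mat_integral N a b F \<in> carrier_mat N N"
  by (simp add: mat_integral_def)

lemma mat_integral_index:
  assumes "i < N" "j < N"
  shows "mat_integral N a b F $$ (i, j) = (LINT x:einterval a b|lebesgue. F x $$ (i, j))"
  using assms by (simp add: mat_integral_def)

lemma mat_integral_cong_AE:
  assumes "\<And>i j. i < N \<Longrightarrow> j < N \<Longrightarrow> set_integrable lebesgue (einterval a b) (\<lambda>x. F x $$ (i, j))"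
    and "\<And>i j. i < N \<Longrightarrow> j < N \<Longrightarrow> set_integrable lebesgue (einterval a b) (\<lambda>x. G x $$ (i, j))"
    and "AE x in lebesgue. x \<in> einterval a b \<longrightarrow> F x = G x"
  shows "mat_integral N a b F = mat_integral N a b G"
proof (rule eq_matI)
  fix i j assume "i < dim_row (mat_integral N a b G)" "j < dim_col (mat_integral N a b G)"
  then have ij: "i < N" "j < N" by (auto simp: mat_integral_def)
  have "(LINT x:einterval a b|lebesgue. F x $$ (i, j)) = (LINT x:einterval a b|lebesgue. G x $$ (i, j))"
    unfolding set_lebesgue_integral_def
  proof (rule Bochner_Integration.integral_cong_AE)
    show "AE x in lebesgue. indicat_real (einterval a b) x *\<^sub>R F x $$ (i, j)
                          = indicat_real (einterval a b) x *\<^sub>R G x $$ (i, j)"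
      using assms(3) by eventually_elim (auto simp: indicator_def)
  qed (use assms(1,2)[OF ij] in \<open>auto simp: set_integrable_def\<close>)
  then show "mat_integral N a b F $$ (i, j) = mat_integral N a b G $$ (i, j)"
    using ij by (simp add: mat_integral_index)
qed (auto simp: mat_integral_def)

lemma mat_integral_cong:
  assumes "\<And>x. x \<in> einterval a b \<Longrightarrow> F x = G x"
  shows "mat_integral N a b F = mat_integral N a b G"
  unfolding mat_integral_def using assms
  by (intro eq_matI) (auto intro!: set_lebesgue_integral_cong)

lemma mat_integral_minus:
  assumes "\<And>i j. i < N \<Longrightarrow> j < N \<Longrightarrow> set_integrable lebesgue (einterval a b) (\<lambda>x. F x $$ (i, j))"
    and "\<And>i j. i < N \<Longrightarrow> j < N \<Longrightarrow> set_integrable lebesgue (einterval a b) (\<lambda>x. G x $$ (i, j))"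
    and "\<And>x. x \<in> einterval a b \<Longrightarrow> G x \<in> carrier_mat N N"
  shows "mat_integral N a b (\<lambda>x. F x - G x) = mat_integral N a b F - mat_integral N a b G"
proof (rule eq_matI)
  fix i j assume "i < dim_row (mat_integral N a b F - mat_integral N a b G)"
    "j < dim_col (mat_integral N a b F - mat_integral N a b G)"
  then have ij: "i < N" "j < N" by (auto simp: mat_integral_def)
  have "(LINT x:einterval a b|lebesgue. (F x - G x) $$ (i, j))
      = (LINT x:einterval a b|lebesgue. F x $$ (i, j) - G x $$ (i, j))"
  proof (intro set_lebesgue_integral_cong allI impI)
    fix x assume "x \<in> einterval a b"
    then show "(F x - G x) $$ (i, j) = F x $$ (i, j) - G x $$ (i, j)"
      using assms(3)[of x] ij by auto
  qed auto
  then show "mat_integral N a b (\<lambda>x. F x - G x) $$ (i, j) = (mat_integral N a b F - mat_integral N a b G) $$ (i, j)"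
    using ij assms by (simp add: mat_integral_def)
qed (auto simp: mat_integral_def)

lemma mat_integral_mult_left:
  assumes C: "C \<in> carrier_mat N N"
    and "\<And>i j. i < N \<Longrightarrow> j < N \<Longrightarrow> set_integrable lebesgue (einterval a b) (\<lambda>x. F x $$ (i, j))"
    and "\<And>x. x \<in> einterval a b \<Longrightarrow> F x \<in> carrier_mat N N"
  shows "mat_integral N a b (\<lambda>x. C * F x) = C * mat_integral N a b F"
proof (rule eq_matI)
  fix i j assume "i < dim_row (C * mat_integral N a b F)" "j < dim_col (C * mat_integral N a b F)"
  then have ij: "i < N" "j < N" using C by (auto simp: mat_integral_def)
  have "(LINT x:einterval a b|lebesgue. (C * F x) $$ (i, j))
      = (LINT x:einterval a b|lebesgue. \<Sum>k<N. C $$ (i, k) * F x $$ (k, j))"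
  proof (intro set_lebesgue_integral_cong allI impI)
    fix x assume "x \<in> einterval a b"
    then show "(C * F x) $$ (i, j) = (\<Sum>k<N. C $$ (i, k) * F x $$ (k, j))"
      using assms(3)[of x] C ij by (auto simp: scalar_prod_def lessThan_atLeast0)
  qed auto
  also have "\<dots> = (\<Sum>k<N. C $$ (i, k) * (LINT x:einterval a b|lebesgue. F x $$ (k, j)))"
    using assms(2) ij by (subst set_integral_sum) auto
  finally show "mat_integral N a b (\<lambda>x. C * F x) $$ (i, j) = (C * mat_integral N a b F) $$ (i, j)"
    using ij C by (simp add: mat_integral_def scalar_prod_def lessThan_atLeast0)
qed (use C in \<open>auto simp: mat_integral_def\<close>)

lemma mat_integral_mult_right:
  assumes C: "C \<in> carrier_mat N N"
    and "\<And>i j. i < N \<Longrightarrow> j < N \<Longrightarrow> set_integrable lebesgue (einterval a b) (\<lambda>x. F x $$ (i, j))"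
    and "\<And>x. x \<in> einterval a b \<Longrightarrow> F x \<in> carrier_mat N N"
  shows "mat_integral N a b (\<lambda>x. F x * C) = mat_integral N a b F * C"
proof (rule eq_matI)
  fix i j assume "i < dim_row (mat_integral N a b F * C)" "j < dim_col (mat_integral N a b F * C)"
  then have ij: "i < N" "j < N" using C by (auto simp: mat_integral_def)
  have "(LINT x:einterval a b|lebesgue. (F x * C) $$ (i, j))
      = (LINT x:einterval a b|lebesgue. \<Sum>k<N. F x $$ (i, k) * C $$ (k, j))"
  proof (intro set_lebesgue_integral_cong allI impI)
    fix x assume "x \<in> einterval a b"
    then show "(F x * C) $$ (i, j) = (\<Sum>k<N. F x $$ (i, k) * C $$ (k, j))"
      using assms(3)[of x] C ij by (auto simp: scalar_prod_def lessThan_atLeast0)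
  qed auto
  also have "\<dots> = (\<Sum>k<N. (LINT x:einterval a b|lebesgue. F x $$ (i, k)) * C $$ (k, j))"
    using assms(2) ij by (subst set_integral_sum) auto
  finally show "mat_integral N a b (\<lambda>x. F x * C) $$ (i, j) = (mat_integral N a b F * C) $$ (i, j)"
    using ij C by (simp add: mat_integral_def scalar_prod_def lessThan_atLeast0)
qed (use C in \<open>auto simp: mat_integral_def\<close>)

section \<open>The matrix-valued form attached to \<open>W\<close>\<close>

locale weight =
  fixes N :: nat and a b :: ereal and W :: "real \<Rightarrow> complex mat"
  assumes weight: "matrix_weight N a b W"
begin

abbreviation J where "J \<equiv> einterval a b"

text \<open>A sesquilinear form over the matrices: constant left factors come out of the first
  argument unchanged on the left, and out of the second as adjoints on the right.\<close>

definition ip :: "complex poly mat \<Rightarrow> complex poly mat \<Rightarrow> complex mat" where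
  "ip P Q = mat_integral N a b (\<lambda>x. mpoly_eval P x * W x * mat_adjoint (mpoly_eval Q x))"

lemma N_pos: "0 < N" and a_less_b: "a < b"
  and W_semidef: "x \<in> J \<Longrightarrow> pos_semidefinite N (W x)"
  and W_pos_def: "AE x in lebesgue. x \<in> J \<longrightarrow> pos_definite N (W x)"
  and moment_integrable: "i < N \<Longrightarrow> j < N \<Longrightarrow> set_integrable lebesgue J (\<lambda>x. of_real (x ^ n) * (W x $$ (i, j)))"
  using weight unfolding matrix_weight_def by blast+

lemma W_carrier: "x \<in> J \<Longrightarrow> W x \<in> carrier_mat N N"
  using W_semidef unfolding pos_semidefinite_def by blast

text \<open>At real points the conjugate of \<open>q\<close> is again a polynomial, with conjugated
  coefficients, so the function is a finite combination of moment integrands.\<close>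

lemma poly_integrable:
  assumes "i < N" "j < N"
  shows "set_integrable lebesgue J (\<lambda>x. poly p (of_real x) * W x $$ (i, j) * cnj (poly q (of_real x)))"
proof -
  have cnj_q: "cnj (poly q (of_real x)) = poly (map_poly cnj q) (of_real x)" for x :: real
    using poly_cnj[of q "of_real x"] by (simp only: complex_cnj_complex_of_real)
  have "set_integrable lebesgue J (\<lambda>x. \<Sum>n\<le>degree (p * map_poly cnj q).
     coeff (p * map_poly cnj q) n * (of_real (x ^ n) * (W x $$ (i, j))))"
    by (intro set_integrable_sum) (rule set_integrable_mult_right[OF moment_integrable[OF assms]])
  moreover have "(\<Sum>n\<le>degree (p * map_poly cnj q). coeff (p * map_poly cnj q) n * (of_real (x ^ n) * (W x $$ (i, j))))
      = poly p (of_real x) * W x $$ (i, j) * cnj (poly q (of_real x))" for x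
  proof -
    have "poly p (of_real x) * W x $$ (i, j) * cnj (poly q (of_real x))
        = poly (p * map_poly cnj q) (of_real x) * W x $$ (i, j)"
      by (simp only: cnj_q poly_mult mult_ac)
    then show ?thesis by (simp only: poly_altdef[of "p * map_poly cnj q"] sum_distrib_right mult.assoc of_real_power)
  qed
  ultimately show ?thesis by simp
qed

lemma eval_sandwich_index:
  assumes "x \<in> J" "P \<in> carrier_mat N N" "Q \<in> carrier_mat N N" "i < N" "j < N"
  shows "(mpoly_eval P x * W x * mat_adjoint (mpoly_eval Q x)) $$ (i, j)
    = (\<Sum>k<N. \<Sum>l<N. poly (P $$ (i, k)) (of_real x) * W x $$ (k, l) * cnj (poly (Q $$ (j, l)) (of_real x)))"
  using assms W_carrier[OF assms(1)]
  by (subst mat_sandwich_index[of _ N N _ N _ N]) (auto simp: mpoly_eval_def)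

lemma ip_integrable:
  assumes "P \<in> carrier_mat N N" "Q \<in> carrier_mat N N" "i < N" "j < N"
  shows "set_integrable lebesgue J (\<lambda>x. (mpoly_eval P x * W x * mat_adjoint (mpoly_eval Q x)) $$ (i, j))"
proof -
  have "set_integrable lebesgue J (\<lambda>x. \<Sum>k<N. \<Sum>l<N.
          poly (P $$ (i, k)) (of_real x) * W x $$ (k, l) * cnj (poly (Q $$ (j, l)) (of_real x)))"
    by (intro set_integrable_sum poly_integrable) auto
  then show ?thesis
    by (rule set_integrable_cong[THEN iffD1, rotated -1]) (use eval_sandwich_index assms in auto)
qed

lemma ip_carrier [simp]: "ip P Q \<in> carrier_mat N N"
  by (simp add: ip_def)

lemma ip_dim [simp]: "dim_row (ip P Q) = N" "dim_col (ip P Q) = N"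
  using ip_carrier[of P Q] unfolding carrier_mat_def by blast+

lemma eval_sandwich_carrier:
  assumes "x \<in> J" "P \<in> carrier_mat N N" "Q \<in> carrier_mat N N"
  shows "mpoly_eval P x * W x * mat_adjoint (mpoly_eval Q x) \<in> carrier_mat N N"
  using assms W_carrier[OF assms(1)]
  by (intro mult_carrier_mat[of _ N N] mat_adjoint_carrier) auto

lemma ip_minus_left:
  assumes "P \<in> carrier_mat N N" "P' \<in> carrier_mat N N" "Q \<in> carrier_mat N N"
  shows "ip (P - P') Q = ip P Q - ip P' Q"
  unfolding ip_def
proof (subst mat_integral_minus[symmetric])
  show "mat_integral N a b (\<lambda>x. mpoly_eval (P - P') x * W x * mat_adjoint (mpoly_eval Q x)) =
    mat_integral N a b (\<lambda>x. mpoly_eval P x * W x * mat_adjoint (mpoly_eval Q x)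
       - mpoly_eval P' x * W x * mat_adjoint (mpoly_eval Q x))"
    using assms W_carrier
    by (intro mat_integral_cong)
       (simp add: mpoly_eval_minus[of _ N N] minus_mult_distrib_mat[of _ N N _ _ N])
qed (auto intro!: ip_integrable eval_sandwich_carrier assms)

lemma ip_minus_right:
  assumes "P \<in> carrier_mat N N" "Q \<in> carrier_mat N N" "Q' \<in> carrier_mat N N"
  shows "ip P (Q - Q') = ip P Q - ip P Q'"
  unfolding ip_def
proof (subst mat_integral_minus[symmetric])
  have "mpoly_eval P x * W x * mat_adjoint (mpoly_eval (Q - Q') x)
     = mpoly_eval P x * W x * mat_adjoint (mpoly_eval Q x) - mpoly_eval P x * W x * mat_adjoint (mpoly_eval Q' x)"
    if "x \<in> J" for x
    using assms W_carrier[OF that]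
    by (simp add: mpoly_eval_minus[of _ N N] mat_adjoint_minus[of _ N N] mult_minus_distrib_mat[of _ N N _ N])
  then show "mat_integral N a b (\<lambda>x. mpoly_eval P x * W x * mat_adjoint (mpoly_eval (Q - Q') x)) =
    mat_integral N a b (\<lambda>x. mpoly_eval P x * W x * mat_adjoint (mpoly_eval Q x)
       - mpoly_eval P x * W x * mat_adjoint (mpoly_eval Q' x))"
    by (rule mat_integral_cong)
qed (auto intro!: ip_integrable eval_sandwich_carrier assms)

lemma ip_const_left:
  assumes "C \<in> carrier_mat N N" "P \<in> carrier_mat N N" "Q \<in> carrier_mat N N"
  shows "ip (const_mpoly C * P) Q = C * ip P Q"
  unfolding ip_def
proof (subst mat_integral_mult_left[symmetric, OF assms(1)])
  have "mpoly_eval (const_mpoly C * P) x * W x * mat_adjoint (mpoly_eval Q x)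
     = C * (mpoly_eval P x * W x * mat_adjoint (mpoly_eval Q x))" if "x \<in> J" for x
    using assms W_carrier[OF that]
    by (simp add: mpoly_eval_mult[of _ N N _ N] assoc_mult_mat[of _ N N _ N _ N])
  then show "mat_integral N a b (\<lambda>x. mpoly_eval (const_mpoly C * P) x * W x * mat_adjoint (mpoly_eval Q x)) =
    mat_integral N a b (\<lambda>x. C * (mpoly_eval P x * W x * mat_adjoint (mpoly_eval Q x)))"
    by (rule mat_integral_cong)
qed (auto intro!: ip_integrable eval_sandwich_carrier assms)

lemma ip_const_right:
  assumes "C \<in> carrier_mat N N" "P \<in> carrier_mat N N" "Q \<in> carrier_mat N N"
  shows "ip P (const_mpoly C * Q) = ip P Q * mat_adjoint C"
  unfolding ip_def
proof (subst mat_integral_mult_right[symmetric, OF mat_adjoint_carrier[OF assms(1)]])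
  have "mpoly_eval P x * W x * mat_adjoint (mpoly_eval (const_mpoly C * Q) x)
     = mpoly_eval P x * W x * mat_adjoint (mpoly_eval Q x) * mat_adjoint C" if "x \<in> J" for x
    using assms W_carrier[OF that]
    by (simp add: mpoly_eval_mult[of _ N N _ N] mat_adjoint_mult[of _ N N _ N] assoc_mult_mat[of _ N N _ N _ N])
  then show "mat_integral N a b (\<lambda>x. mpoly_eval P x * W x * mat_adjoint (mpoly_eval (const_mpoly C * Q) x)) =
    mat_integral N a b (\<lambda>x. mpoly_eval P x * W x * mat_adjoint (mpoly_eval Q x) * mat_adjoint C)"
    by (rule mat_integral_cong)
qed (auto intro!: ip_integrable eval_sandwich_carrier assms)

text \<open>The relation \<open>TW\<close> lets \<open>T\<close> cross \<open>W\<close> as its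
  adjoint, which makes right multiplication by \<open>T\<close> symmetric for
  \<open>ip\<close>.\<close>

lemma ip_mult_const_swap:
  assumes T: "T \<in> carrier_mat N N" and P: "P \<in> carrier_mat N N" and Q: "Q \<in> carrier_mat N N"
    and TW: "AE x in lebesgue. x \<in> J \<longrightarrow> T * W x = W x * mat_adjoint T"
  shows "ip (P * const_mpoly T) Q = ip P (Q * const_mpoly T)"
  unfolding ip_def
proof (rule mat_integral_cong_AE)
  show "AE x in lebesgue. x \<in> J \<longrightarrow>
     mpoly_eval (P * const_mpoly T) x * W x * mat_adjoint (mpoly_eval Q x)
     = mpoly_eval P x * W x * mat_adjoint (mpoly_eval (Q * const_mpoly T) x)"
    using TW
  proof eventually_elim
    case (elim x)
    show ?case
    proof
      assume "x \<in> J"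
      with elim have TWx: "T * W x = W x * mat_adjoint T" and W: "W x \<in> carrier_mat N N"
        using W_carrier by auto
      have e: "mpoly_eval P x \<in> carrier_mat N N" "mat_adjoint (mpoly_eval Q x) \<in> carrier_mat N N"
        "mat_adjoint T \<in> carrier_mat N N" "mpoly_eval Q x \<in> carrier_mat N N"
        using P Q T by auto
      note assoc = assoc_mult_mat[of _ N N _ N _ N]
      have "mpoly_eval (P * const_mpoly T) x * W x * mat_adjoint (mpoly_eval Q x)
         = mpoly_eval P x * (T * W x) * mat_adjoint (mpoly_eval Q x)"
        using P Q T W e(1) by (simp add: mpoly_eval_mult[of _ N N _ N] assoc)
      also have "\<dots> = mpoly_eval P x * (W x * mat_adjoint T) * mat_adjoint (mpoly_eval Q x)"
        unfolding TWx ..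
      also have "\<dots> = mpoly_eval P x * W x * (mat_adjoint T * mat_adjoint (mpoly_eval Q x))"
        unfolding assoc[OF e(1) W e(3), symmetric]
        by (rule assoc[OF _ e(3) e(2)]) (use e W in auto)
      also have "mat_adjoint T * mat_adjoint (mpoly_eval Q x) = mat_adjoint (mpoly_eval (Q * const_mpoly T) x)"
        using Q T e by (simp add: mpoly_eval_mult[of _ N N _ N] mat_adjoint_mult[of _ N N _ N])
      finally show "mpoly_eval (P * const_mpoly T) x * W x * mat_adjoint (mpoly_eval Q x)
        = mpoly_eval P x * W x * mat_adjoint (mpoly_eval (Q * const_mpoly T) x)" .
    qed
  qed
qed (use assms in \<open>auto intro!: ip_integrable\<close>)

text \<open>The diagonal entries of the integrand are nonnegative with integral zero, so they vanish
  almost everywhere. Where \<open>W x\<close> is also definite, \<open>R\<close> evaluates to zero,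
  and this happens at infinitely many points.\<close>

lemma ip_self_eq_zero:
  assumes R: "R \<in> carrier_mat N N" and zero: "ip R R = 0\<^sub>m N N"
  shows "R = 0\<^sub>m N N"
proof -
  let ?F = "\<lambda>x. mpoly_eval R x * W x * mat_adjoint (mpoly_eval R x)"
  have "AE x in lebesgue. x \<in> J \<longrightarrow> (\<forall>i<N. ?F x $$ (i, i) = 0)"
  proof -
    have "AE x in lebesgue. x \<in> J \<longrightarrow> ?F x $$ (i, i) = 0" if i: "i < N" for i
    proof -
      have pos: "0 \<le> ?F x $$ (i, i)" if "x \<in> J" for x
        using W_semidef[OF that] R i
        by (subst mat_adjoint_mult_vec_index[of _ N N]) (auto simp: pos_semidefinite_def)
      let ?f = "\<lambda>x. indicator J x *\<^sub>R ?F x $$ (i, i)"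
      have int: "integrable lebesgue ?f"
        using ip_integrable[OF R R i i] by (simp add: set_integrable_def)
      have "(\<integral>x. ?f x \<partial>lebesgue) = ip R R $$ (i, i)"
        using i by (simp add: ip_def mat_integral_index set_lebesgue_integral_def)
      then have "(\<integral>x. Re (?f x) \<partial>lebesgue) = 0"
        using zero i integral_Re[OF int] by simp
      then have "AE x in lebesgue. Re (?f x) = 0"
        using integral_nonneg_eq_0_iff_AE[OF integrable_Re[OF int]] pos
        by (auto simp: indicator_def less_eq_complex_def)
      then show ?thesis
        by eventually_elim (use pos in \<open>auto simp: less_eq_complex_def complex_eq_iff\<close>)
    qed
    then have "AE x in lebesgue. \<forall>i. i < N \<longrightarrow> x \<in> J \<longrightarrow> ?F x $$ (i, i) = 0"
      by (simp add: AE_all_countable)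
    then show ?thesis by eventually_elim auto
  qed
  with W_pos_def have "AE x in lebesgue. x \<in> J \<longrightarrow> mpoly_eval R x = mpoly_eval (0\<^sub>m N N) x"
  proof eventually_elim
    case (elim x)
    then show ?case using R by (auto intro!: pos_definite_eq_zero[of N "W x"])
  qed
  then have "infinite {x \<in> J. mpoly_eval R x = mpoly_eval (0\<^sub>m N N) x}"
    by (rule AE_on_einterval_infinite[OF a_less_b])
  then show ?thesis using R by (intro mpoly_eq_if_eval_eq) auto
qed

end

section \<open>The three term recursion\<close>

lemma mat_commute_add:
  fixes Q X Y :: "'a :: comm_ring_1 mat"
  assumes "Q \<in> carrier_mat n n" "X \<in> carrier_mat n n" "Y \<in> carrier_mat n n"
    and "Q * X = X * Q" "Q * Y = Y * Q"
  shows "Q * (X + Y) = (X + Y) * Q"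
  using assms by (simp add: mult_add_distrib_mat[of _ n n _ n] add_mult_distrib_mat[of _ n n _ _ n])

lemma mat_commute_minus:
  fixes Q X Y :: "'a :: comm_ring_1 mat"
  assumes "Q \<in> carrier_mat n n" "X \<in> carrier_mat n n" "Y \<in> carrier_mat n n"
    and "Q * X = X * Q" "Q * Y = Y * Q"
  shows "Q * (X - Y) = (X - Y) * Q"
  using assms by (simp add: mult_minus_distrib_mat[of _ n n _ n] minus_mult_distrib_mat[of _ n n _ _ n])

lemma mat_commute_mult:
  fixes Q X Y :: "'a :: comm_ring_1 mat"
  assumes Q: "Q \<in> carrier_mat n n" and X: "X \<in> carrier_mat n n" and Y: "Y \<in> carrier_mat n n"
    and "Q * X = X * Q" "Q * Y = Y * Q"
  shows "Q * (X * Y) = (X * Y) * Q"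
  using assoc_mult_mat[OF Q X Y] assoc_mult_mat[OF X Q Y] assoc_mult_mat[OF X Y Q] assms(4,5) by simp

lemma mat_commute_smult:
  fixes Q X :: "'a :: comm_ring_1 mat"
  assumes "Q \<in> carrier_mat n n" "X \<in> carrier_mat n n" "Q * X = X * Q"
  shows "Q * (c \<cdot>\<^sub>m X) = (c \<cdot>\<^sub>m X) * Q"
  using assms by (simp add: mult_smult_distrib[of _ n n _ n] mult_smult_assoc_mat[of _ n n _ n])

lemma mat_diff_eq_zeroD:
  fixes X Y :: "'a :: ab_group_add mat"
  assumes "X \<in> carrier_mat n m" "Y \<in> carrier_mat n m" "X - Y = 0\<^sub>m n m"
  shows "X = Y"
proof (rule eq_matI)
  fix i j assume "i < dim_row Y" "j < dim_col Y"
  then have ij: "i < n" "j < m" using assms by auto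
  have "(X - Y) $$ (i, j) = 0" unfolding assms(3) using ij by simp
  then show "X $$ (i, j) = Y $$ (i, j)" using ij assms(1,2) by simp
qed (use assms in auto)

lemma mat_add_eq_imp_eq_diff:
  fixes X Y :: "'a :: ab_group_add mat"
  assumes "X \<in> carrier_mat n m" "Y \<in> carrier_mat n m" "X + Y = Z"
  shows "Y = Z - X"
  unfolding assms(3)[symmetric] using assms(1,2) by (intro eq_matI) auto

section \<open>Matrices commuting with the orthogonal polynomials and with the recursion
  coefficients\<close>

locale weight_polys = weight +
  fixes P :: "nat \<Rightarrow> complex poly mat" and A B :: "nat \<Rightarrow> complex mat"
  assumes orth: "monic_orthogonal_polys N a b W P"
    and recursion: "three_term_recursion N A B P"
begin

lemma P_monic: "monic_mpoly N n (P n)"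
  and ip_P: "n \<noteq> m \<Longrightarrow> ip (P n) (P m) = 0\<^sub>m N N"
  using orth unfolding monic_orthogonal_polys_def ip_def by blast+

lemma P_carrier [simp]: "P n \<in> carrier_mat N N"
  and P_lead: "mpoly_coeff (P n) n = 1\<^sub>m N"
  and P_deg: "k > n \<Longrightarrow> mpoly_coeff (P n) k = 0\<^sub>m N N"
  using P_monic[of n] unfolding monic_mpoly_def by blast+

lemma P_dim [simp]: "dim_row (P n) = N" "dim_col (P n) = N"
  using P_carrier[of n] unfolding carrier_mat_def by blast+

lemma P_0: "P 0 = 1\<^sub>m N"
  by (rule monic_mpoly_0[OF P_monic])

lemma A_carrier [simp]: "A n \<in> carrier_mat N N" and B_carrier [simp]: "B n \<in> carrier_mat N N"
  and A_0: "A 0 = 0\<^sub>m N N"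
  using recursion unfolding three_term_recursion_def by blast+

lemma AB_dim [simp]: "dim_row (A n) = N" "dim_col (A n) = N" "dim_row (B n) = N" "dim_col (B n) = N"
  using A_carrier[of n] B_carrier[of n] unfolding carrier_mat_def by blast+

text \<open>Peeling off leading terms writes \<open>G\<close> as a combination of the
  \<open>P m\<close> with \<open>m < n\<close> and matrix coefficients on the left, and
  \<open>F\<close> is orthogonal to each of them.\<close>

lemma ip_eq_zero_if_deg_less:
  assumes F: "F \<in> carrier_mat N N"
  shows "(\<And>m. m < n \<Longrightarrow> ip F (P m) = 0\<^sub>m N N) \<Longrightarrow> mpoly_deg_less N n G \<Longrightarrow> ip F G = 0\<^sub>m N N"
proof (induction n arbitrary: G)
  case 0
  have "ip F (0\<^sub>m N N - 0\<^sub>m N N) = ip F (0\<^sub>m N N) - ip F (0\<^sub>m N N)"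
    by (rule ip_minus_right[OF F]) auto
  then show ?case using mpoly_deg_less_0[OF 0(2)] by (simp add: minus_r_inv_mat[of _ N N])
next
  case (Suc n)
  define C where "C = mpoly_coeff G n"
  have G: "G \<in> carrier_mat N N" and C: "C \<in> carrier_mat N N"
    using Suc.prems(2) by (auto simp: mpoly_deg_less_def C_def)
  have "ip F (G - const_mpoly C * P n) = 0\<^sub>m N N"
    unfolding C_def
    by (rule Suc.IH[OF Suc.prems(1) mpoly_deg_less_reduce[OF Suc.prems(2) P_monic]]) simp
  moreover have "ip F (G - const_mpoly C * P n) = ip F G - ip F (P n) * mat_adjoint C"
    using C by (subst ip_minus_right[OF F G]) (auto simp: ip_const_right[OF C F] intro!: mult_carrier_mat[of _ N N])
  ultimately have "ip F G - ip F (P n) * mat_adjoint C = 0\<^sub>m N N" by simp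
  then have "ip F G = ip F (P n) * mat_adjoint C"
    by (rule mat_diff_eq_zeroD[rotated 2]) (use C in \<open>auto intro!: mult_carrier_mat[of _ N N]\<close>)
  then show ?case using Suc.prems(1)[of n] C by simp
qed

abbreviation P_pred where "P_pred n \<equiv> (if n = 0 then 0\<^sub>m N N else P (n - 1))"

text \<open>The recursion is assumed for values at real points; agreement at infinitely many points
  lifts it to polynomials, where coefficients can be compared.\<close>

lemma recursion_poly:
  "const_mpoly (A n) * P_pred n + const_mpoly (B n) * P n + P (Suc n) = [:0, 1:] \<cdot>\<^sub>m P n"
proof (rule mpoly_eq_if_eval_eq[of _ N N _ UNIV])
  fix x :: real
  have "A n * (if n = 0 then 0\<^sub>m N N else mpoly_eval (P (n - 1)) x)
      + B n * mpoly_eval (P n) x + mpoly_eval (P (Suc n)) x = of_real x \<cdot>\<^sub>m mpoly_eval (P n) x"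
    using recursion unfolding three_term_recursion_def by blast
  moreover have "(if n = 0 then 0\<^sub>m N N else mpoly_eval (P (n - 1)) x) = mpoly_eval (P_pred n) x"
    by simp
  moreover have "P_pred n \<in> carrier_mat N N" by simp
  moreover have cA: "const_mpoly (A n) \<in> carrier_mat N N" and cB: "const_mpoly (B n) \<in> carrier_mat N N"
    by simp_all
  ultimately show "mpoly_eval (const_mpoly (A n) * P_pred n + const_mpoly (B n) * P n + P (Suc n)) x
      = mpoly_eval ([:0, 1:] \<cdot>\<^sub>m P n) x"
    by (simp only: mpoly_eval_add[OF add_carrier_mat[OF mult_carrier_mat[OF cB P_carrier]] P_carrier]
        mpoly_eval_add[OF mult_carrier_mat[OF cA] mult_carrier_mat[OF cB P_carrier]]
        mpoly_eval_mult[OF cA] mpoly_eval_mult[OF cB P_carrier] mpoly_eval_const mpoly_eval_smult) simp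
qed (auto intro!: add_carrier_mat mult_carrier_mat[of _ N N] simp: infinite_UNIV_char_0)

text \<open>The commutator \<open>R\<close> has degree below \<open>n\<close> and is orthogonal to
  every \<open>P m\<close> with \<open>m < n\<close>, hence to itself.\<close>

lemma commute_P_if_commute_weight:
  assumes T: "T \<in> carrier_mat N N"
    and TW: "AE x in lebesgue. x \<in> J \<longrightarrow> T * W x = W x * mat_adjoint T"
  shows "const_mpoly T * P n = P n * const_mpoly T"
proof -
  define R where "R = const_mpoly T * P n - P n * const_mpoly T"
  have c: "const_mpoly T * P n \<in> carrier_mat N N" "P n * const_mpoly T \<in> carrier_mat N N" for n
    using T by (auto intro!: mult_carrier_mat[of _ N N])
  have R: "R \<in> carrier_mat N N" unfolding R_def by (rule minus_carrier_mat[OF c(2)])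
  have deg: "mpoly_deg_less N n R"
    unfolding mpoly_deg_less_def
  proof (intro conjI R allI impI)
    fix k assume "n \<le> k"
    have "mpoly_coeff R k = T * mpoly_coeff (P n) k - mpoly_coeff (P n) k * T"
      unfolding R_def mpoly_coeff_minus[OF c]
      using T by (simp add: mpoly_coeff_const_mult[of _ N N _ N] mpoly_coeff_mult_const[of _ N N _ N])
    then show "mpoly_coeff R k = 0\<^sub>m N N"
      \<comment> \<open>For \<open>k = n\<close> both products equal \<open>T\<close>, because
        \<open>P n\<close> is monic; this is where the degree drops.\<close>
      using \<open>n \<le> k\<close> T P_lead P_deg[of n k] by (cases "k = n") auto
  qed
  have "ip R (P m) = 0\<^sub>m N N" if "m < n" for m
  proof -
    have "ip (P n * const_mpoly T) (P m) = ip (P n) (P m * const_mpoly T)"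
      by (rule ip_mult_const_swap[OF T _ _ TW]) auto
    also have "\<dots> = 0\<^sub>m N N"
    proof (rule ip_eq_zero_if_deg_less[of _ n])
      show "mpoly_deg_less N n (P m * const_mpoly T)"
        unfolding mpoly_deg_less_def
        using that T P_deg[of m] c by (auto simp: mpoly_coeff_mult_const[of _ N N _ N])
    qed (auto intro!: ip_P)
    finally show ?thesis
      unfolding R_def ip_minus_left[OF c P_carrier] using that T by (simp add: ip_const_left ip_P)
  qed
  then have "ip R R = 0\<^sub>m N N" by (rule ip_eq_zero_if_deg_less[OF R _ deg])
  then have "R = 0\<^sub>m N N" by (rule ip_self_eq_zero[OF R])
  then show ?thesis unfolding R_def by (rule mat_diff_eq_zeroD[OF c])
qed

lemma commute_AB_if_commute_P:
  assumes T: "T \<in> carrier_mat N N" and TP: "\<And>n. const_mpoly T * P n = P n * const_mpoly T"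
  shows "T * A n = A n * T \<and> T * B n = B n * T"
proof -
  have c: "const_mpoly C * P_pred n \<in> carrier_mat N N" "const_mpoly C * P n \<in> carrier_mat N N"
    if "C \<in> carrier_mat N N" for C
    using that by (auto intro!: mult_carrier_mat[of _ N N])
  have cT: "const_mpoly T \<in> carrier_mat N N" using T by simp
  \<comment> \<open>Written as \<open>x P\<^sub>n - P\<^sub>n\<^sub>+\<^sub>1\<close>, the sum
    \<open>S\<close> commutes with \<open>T\<close>, and so do its coefficients. The coefficient at
    \<open>n\<close> yields \<open>B n\<close>, after which the one at \<open>n - 1\<close> yields
    \<open>A n\<close>.\<close>
  define S where "S = const_mpoly (A n) * P_pred n + const_mpoly (B n) * P n"
  have S: "S \<in> carrier_mat N N" unfolding S_def by (intro add_carrier_mat c) simp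
  have coeff_S: "mpoly_coeff S k = A n * mpoly_coeff (P_pred n) k + B n * mpoly_coeff (P n) k" for k
    unfolding S_def mpoly_coeff_add[OF c(1)[OF A_carrier] c(2)[OF B_carrier]]
    by (simp add: mpoly_coeff_const_mult[of _ N N _ N])
  have "S = [:0, 1:] \<cdot>\<^sub>m P n - P (Suc n)"
    unfolding recursion_poly[of n, symmetric] S_def[symmetric] using S by (intro eq_matI) auto
  then have "const_mpoly T * S = S * const_mpoly T"
    using TP by (auto intro!: mat_commute_minus[OF cT] mat_commute_smult[OF cT])
  then have coeff: "T * mpoly_coeff S k = mpoly_coeff S k * T" for k
    using mpoly_coeff_const_mult[OF T S, of k] mpoly_coeff_mult_const[OF S T, of k] by simp
  have pred_n: "mpoly_coeff (P_pred n) n = 0\<^sub>m N N"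
    using P_deg[of "n - 1" n] by (auto simp: mpoly_coeff_def intro!: eq_matI)
  have "mpoly_coeff S n = B n" unfolding coeff_S pred_n P_lead
    by (simp only: right_mult_zero_mat[OF A_carrier] right_mult_one_mat[OF B_carrier] left_add_zero_mat[OF B_carrier])
  then have TB: "T * B n = B n * T" using coeff[of n] by simp
  have TA: "T * A n = A n * T"
  proof (cases n)
    case 0
    then show ?thesis using A_0 T by simp
  next
    case (Suc m)
    have TPm: "T * mpoly_coeff (P n) m = mpoly_coeff (P n) m * T"
      using TP[of n] mpoly_coeff_const_mult[OF T P_carrier, of n m] mpoly_coeff_mult_const[OF P_carrier T, of n m]
      by simp
    \<comment> \<open>Here \<open>P m\<close> is monic of degree \<open>m = n - 1\<close>, so
      \<open>A n\<close> appears up to a term already known to commute with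
      \<open>T\<close>.\<close>
    have Sm: "mpoly_coeff S m = A n + B n * mpoly_coeff (P n) m"
      unfolding coeff_S using Suc by (simp add: P_lead right_mult_one_mat[OF A_carrier])
    have BP: "B n * mpoly_coeff (P n) m \<in> carrier_mat N N" by (auto intro!: mult_carrier_mat[of _ N N])
    have "T * (B n * mpoly_coeff (P n) m) = (B n * mpoly_coeff (P n) m) * T"
      by (rule mat_commute_mult[OF T _ _ TB TPm]) auto
    moreover have "A n = (A n + B n * mpoly_coeff (P n) m) - B n * mpoly_coeff (P n) m"
      using BP by (intro eq_matI) auto
    ultimately show ?thesis
      using mat_commute_minus[OF T _ BP, of "A n + B n * mpoly_coeff (P n) m"] coeff[of m] BP
      unfolding Sm by simp
  qed
  from TA TB show ?thesis ..
qed

text \<open>Solving the recursion for its last term expresses each polynomial through its two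
  predecessors, hence the strong induction, which starts from the identity
  \<open>P 0\<close>.\<close>

lemma commute_P_if_commute_AB:
  assumes T: "T \<in> carrier_mat N N" and TAB: "\<And>n. T * A n = A n * T \<and> T * B n = B n * T"
  shows "const_mpoly T * P n = P n * const_mpoly T"
proof (induction n rule: less_induct)
  case (less n)
  have cT: "const_mpoly T \<in> carrier_mat N N" using T by simp
  show ?case
  proof (cases n)
    case 0
    then show ?thesis using cT by (simp add: P_0)
  next
    case (Suc m)
    have c: "const_mpoly (A m) * P_pred m \<in> carrier_mat N N" "const_mpoly (B m) * P m \<in> carrier_mat N N"
      by (auto intro!: mult_carrier_mat[of _ N N])
    have comm: "const_mpoly T * const_mpoly (A m) = const_mpoly (A m) * const_mpoly T"
      "const_mpoly T * const_mpoly (B m) = const_mpoly (B m) * const_mpoly T"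
      using TAB[of m] T by (auto simp flip: const_mpoly_mult[of _ N N _ N])
    have "P n = [:0, 1:] \<cdot>\<^sub>m P m - (const_mpoly (A m) * P_pred m + const_mpoly (B m) * P m)"
      unfolding Suc by (rule mat_add_eq_imp_eq_diff[OF _ P_carrier recursion_poly]) (intro add_carrier_mat c)
    moreover have TPm: "const_mpoly T * P m = P m * const_mpoly T"
      by (rule less.IH) (simp add: Suc)
    have TPp: "const_mpoly T * P_pred m = P_pred m * const_mpoly T"
    proof (cases "m = 0")
      case True
      then show ?thesis using cT by simp
    next
      case False
      then have "const_mpoly T * P (m - 1) = P (m - 1) * const_mpoly T"
        by (intro less.IH) (simp add: Suc)
      then show ?thesis using False by simp
    qed
    have "const_mpoly T * (const_mpoly (A m) * P_pred m + const_mpoly (B m) * P m)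
        = (const_mpoly (A m) * P_pred m + const_mpoly (B m) * P m) * const_mpoly T"
      by (rule mat_commute_add[OF cT c mat_commute_mult[OF cT _ _ comm(1) TPp] mat_commute_mult[OF cT _ _ comm(2) TPm]])
         simp_all
    from mat_commute_minus[OF cT _ _ mat_commute_smult[OF cT P_carrier TPm] this, of "[:0, 1:]"]
    have "const_mpoly T * ([:0, 1:] \<cdot>\<^sub>m P m - (const_mpoly (A m) * P_pred m + const_mpoly (B m) * P m))
        = ([:0, 1:] \<cdot>\<^sub>m P m - (const_mpoly (A m) * P_pred m + const_mpoly (B m) * P m)) * const_mpoly T"
      by (rule meta_mp) (use c in \<open>auto intro!: add_carrier_mat\<close>)
    ultimately show ?thesis by simp
  qed
qed

end

section \<open>Reduction\<close>

text \<open>The block is \<open>S W S\<^sup>*\<close>, where \<open>S\<close> consists of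
  \<open>k\<close> consecutive rows of \<open>M\<close>. The matching columns of \<open>L\<close>
  form a right inverse \<open>R\<close> of \<open>S\<close>, so \<open>S\<^sup>*\<close> is
  injective and definiteness passes from \<open>W\<close> to the block.\<close>

lemma weight_block:
  assumes W: "matrix_weight N a b W" and M: "M \<in> carrier_mat N N" and L: "L \<in> carrier_mat N N" "M * L = 1\<^sub>m N"
    and k: "0 < k" "s + k \<le> N"
  shows "matrix_weight k a b (\<lambda>x. mat k k (\<lambda>(i, j). (M * W x * mat_adjoint M) $$ (i + s, j + s)))"
proof -
  interpret weight N a b W by standard (rule W)
  define S where "S = mat k N (\<lambda>(i, j). M $$ (i + s, j))"
  define R where "R = mat N k (\<lambda>(i, j). L $$ (i, j + s))"
  define V where "V x = mat k k (\<lambda>(i, j). (M * W x * mat_adjoint M) $$ (i + s, j + s))" for x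
  have S: "S \<in> carrier_mat k N" and R: "R \<in> carrier_mat N k" by (simp_all add: S_def R_def)
  have SR: "S * R = 1\<^sub>m k"
  proof (rule eq_matI)
    fix i j assume "i < dim_row (1\<^sub>m k :: complex mat)" "j < dim_col (1\<^sub>m k :: complex mat)"
    then have ij: "i < k" "j < k" by auto
    have "(S * R) $$ (i, j) = (\<Sum>l<N. M $$ (i + s, l) * L $$ (l, j + s))"
      using ij by (simp add: S_def R_def scalar_prod_def lessThan_atLeast0)
    also have "\<dots> = (M * L) $$ (i + s, j + s)"
      using ij k M L(1) by (simp add: scalar_prod_def lessThan_atLeast0)
    finally show "(S * R) $$ (i, j) = 1\<^sub>m k $$ (i, j)" using ij k unfolding L(2) by simp
  qed (auto simp: S_def R_def)
  have V_index: "V x $$ (i, j) = (\<Sum>p<N. \<Sum>q<N. S $$ (i, p) * W x $$ (p, q) * cnj (S $$ (j, q)))"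
    if "x \<in> J" "i < k" "j < k" for x i j
  proof -
    have "V x $$ (i, j) = (M * W x * mat_adjoint M) $$ (i + s, j + s)" using that by (simp add: V_def)
    also have "\<dots> = (\<Sum>p<N. \<Sum>q<N. M $$ (i + s, p) * W x $$ (p, q) * cnj (M $$ (j + s, q)))"
      by (rule mat_sandwich_index[OF M W_carrier[OF that(1)] M]) (use that k in auto)
    finally show ?thesis using that by (simp add: S_def)
  qed
  have V_eq: "V x = S * W x * mat_adjoint S" if "x \<in> J" for x
  proof (rule eq_matI)
    fix i j assume "i < dim_row (S * W x * mat_adjoint S)" "j < dim_col (S * W x * mat_adjoint S)"
    then have ij: "i < k" "j < k" using S by auto
    show "V x $$ (i, j) = (S * W x * mat_adjoint S) $$ (i, j)"
      unfolding V_index[OF that ij] mat_sandwich_index[OF S W_carrier[OF that] S ij] ..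
  qed (use S in \<open>auto simp: V_def\<close>)
  have form: "(V x *\<^sub>v v) \<bullet>c v = (W x *\<^sub>v (mat_adjoint S *\<^sub>v v)) \<bullet>c (mat_adjoint S *\<^sub>v v)"
    if x: "x \<in> J" and v: "v \<in> carrier_vec k" for x v
  proof -
    have Sv: "mat_adjoint S *\<^sub>v v \<in> carrier_vec N" using S v by (intro mult_mat_vec_carrier) auto
    have "V x *\<^sub>v v = S *\<^sub>v (W x *\<^sub>v (mat_adjoint S *\<^sub>v v))"
      unfolding V_eq[OF x] using assoc_mult_mat_vec[OF mult_carrier_mat[OF S W_carrier[OF x]] mat_adjoint_carrier[OF S] v]
        assoc_mult_mat_vec[OF S W_carrier[OF x] Sv] by simp
    then show ?thesis
      using mult_mat_vec_cscalar_prod[OF S mult_mat_vec_carrier[OF W_carrier[OF x] Sv] v] by simp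
  qed
  have inj: "v = 0\<^sub>v k" if v: "v \<in> carrier_vec k" and "mat_adjoint S *\<^sub>v v = 0\<^sub>v N" for v
  proof -
    have "mat_adjoint R *\<^sub>v (mat_adjoint S *\<^sub>v v) = mat_adjoint (S * R) *\<^sub>v v"
      unfolding mat_adjoint_mult[OF S R]
      using assoc_mult_mat_vec[OF mat_adjoint_carrier[OF R] mat_adjoint_carrier[OF S] v] by simp
    then have "v = mat_adjoint R *\<^sub>v (mat_adjoint S *\<^sub>v v)" unfolding SR using v by simp
    also have "\<dots> = 0\<^sub>v k" unfolding that(2) using R by (intro eq_vecI) auto
    finally show ?thesis .
  qed
  have Sv: "mat_adjoint S *\<^sub>v v \<in> carrier_vec N" if "v \<in> carrier_vec k" for v
    using S that by (intro mult_mat_vec_carrier) auto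
  have "matrix_weight k a b V"
    unfolding matrix_weight_def
  proof (intro conjI ballI allI impI)
    show "0 < k" "a < b" by (rule k a_less_b)+
  next
    fix x assume x: "x \<in> J"
    show "pos_semidefinite k (V x)"
      unfolding pos_semidefinite_def
    proof (intro conjI ballI)
      fix v :: "complex Matrix.vec" assume v: "v \<in> carrier_vec k"
      show "0 \<le> (V x *\<^sub>v v) \<bullet>c v"
        unfolding form[OF x v] using W_semidef[OF x] Sv[OF v] unfolding pos_semidefinite_def by blast
    qed (simp add: V_def)
  next
    show "AE x in lebesgue. x \<in> J \<longrightarrow> pos_definite k (V x)"
      using W_pos_def
    proof eventually_elim
      case (elim x)
      show ?case
        unfolding pos_definite_def
      proof (intro impI conjI ballI)
        fix v :: "complex Matrix.vec" assume x: "x \<in> J" and v: "v \<in> carrier_vec k" "v \<noteq> 0\<^sub>v k"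
        have "pos_definite N (W x)" using elim x by simp
        moreover have "mat_adjoint S *\<^sub>v v \<noteq> 0\<^sub>v N" using inj[OF v(1)] v(2) by blast
        ultimately show "0 < (V x *\<^sub>v v) \<bullet>c v"
          unfolding form[OF x v(1)] using Sv[OF v(1)] unfolding pos_definite_def by blast
      qed (simp add: V_def)
    qed
  next
    fix n i j assume ij: "i < k" "j < k"
    have eq: "of_real (x ^ n) * V x $$ (i, j)
      = (\<Sum>p<N. \<Sum>q<N. S $$ (i, p) * cnj (S $$ (j, q)) * (of_real (x ^ n) * W x $$ (p, q)))" if "x \<in> J" for x
      unfolding V_index[OF that ij] sum_distrib_left by (intro sum.cong refl) (simp only: mult_ac)
    have "set_integrable lebesgue J (\<lambda>x. \<Sum>p<N. \<Sum>q<N. S $$ (i, p) * cnj (S $$ (j, q)) * (of_real (x ^ n) * W x $$ (p, q)))"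
      by (intro set_integrable_sum) (rule set_integrable_mult_right[OF moment_integrable]; simp)
    then show "set_integrable lebesgue J (\<lambda>x. of_real (x ^ n) * V x $$ (i, j))"
      by (rule set_integrable_cong[THEN iffD1, rotated -1]) (use eq in auto)
  qed
  then show ?thesis unfolding V_def .
qed

text \<open>The projection keeps the first \<open>k\<close> rows when it acts from the left and the
  first \<open>k\<close> columns when it acts from the right. The results differ only in the
  off-diagonal blocks, which are zero.\<close>

lemma block_projection_commute:
  fixes V :: "complex mat"
  defines "F \<equiv> \<lambda>n k. mat n n (\<lambda>(i, j). if i = j \<and> i < k then 1 else 0) :: complex mat"
  assumes V: "V \<in> carrier_mat n n" and off: "\<And>i j. i < n \<Longrightarrow> j < n \<Longrightarrow> (i < k) \<noteq> (j < k) \<Longrightarrow> V $$ (i, j) = 0"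
  shows "F n k * V = V * F n k"
proof (rule eq_matI)
  fix i j assume "i < dim_row (V * F n k)" "j < dim_col (V * F n k)"
  then have ij: "i < n" "j < n" using V by (auto simp: F_def)
  have "(F n k * V) $$ (i, j) = (\<Sum>l<n. (if i = l \<and> i < k then 1 else 0) * V $$ (l, j))"
    using ij V by (simp add: F_def scalar_prod_def lessThan_atLeast0)
  also have "\<dots> = (\<Sum>l<n. if l = i then (if i < k then V $$ (l, j) else 0) else 0)"
    by (intro sum.cong) auto
  finally have "(F n k * V) $$ (i, j) = (if i < k then V $$ (i, j) else 0)"
    using ij by (simp add: sum.delta)
  moreover have "(V * F n k) $$ (i, j) = (\<Sum>l<n. V $$ (i, l) * (if l = j \<and> l < k then 1 else 0))"
    using ij V by (simp add: F_def scalar_prod_def lessThan_atLeast0)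
  moreover have "\<dots> = (\<Sum>l<n. if l = j then (if j < k then V $$ (i, l) else 0) else 0)"
    by (intro sum.cong) auto
  moreover have "\<dots> = (if j < k then V $$ (i, j) else 0)"
    using ij by (simp add: sum.delta)
  ultimately show "(F n k * V) $$ (i, j) = (V * F n k) $$ (i, j)"
    using off[OF ij] by presburger
qed (use V in \<open>auto simp: F_def\<close>)

lemma (in weight) commuting_matrix_if_reduces:
  assumes "weight_reduces N a b W"
  shows "\<exists>T \<in> carrier_mat N N. \<not> scalar_matrix N T \<and>
     (AE x in lebesgue. x \<in> J \<longrightarrow> T * W x = W x * mat_adjoint T)"
proof -
  obtain Vs M where Vs: "\<And>k V. (k, V) \<in> set Vs \<Longrightarrow> k < N \<and> matrix_weight k a b V"
    and sum: "sum_list (map fst Vs) = N" and M: "M \<in> carrier_mat N N" "invertible_mat M"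
    and eq: "AE x in lebesgue. x \<in> J \<longrightarrow> weight_direct_sum Vs x = M * W x * mat_adjoint M"
    using assms unfolding weight_reduces_def weight_equiv_def by blast
  obtain L where L: "L \<in> carrier_mat N N" "M * L = 1\<^sub>m N" "L * M = 1\<^sub>m N"
    by (rule invertible_matE[OF M(2,1)])
  have "Vs \<noteq> []" using sum N_pos by auto
  then obtain k V Vs' where Vs_eq: "Vs = (k, V) # Vs'" by (cases Vs) auto
  interpret V: weight k a b V by standard (use Vs Vs_eq in auto)
  \<comment> \<open>A weight has positive size, and the summands of a reduction are smaller than
    \<open>N\<close>. All summands after the first are treated as one complementary block.\<close>
  have k: "0 < k" "k < N" using Vs[of k V] V.N_pos by (auto simp: Vs_eq)
  define F where "F = mat N N (\<lambda>(i, j). if i = j \<and> i < k then 1 else 0 :: complex)"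
  have F: "F \<in> carrier_mat N N" by (simp add: F_def)
  have Fadj: "mat_adjoint F = F" by (intro eq_matI) (auto simp: F_def)
  define T where "T = L * F * M"
  have T: "T \<in> carrier_mat N N" using L F M by (auto simp: T_def intro!: mult_carrier_mat)
  note assoc = assoc_mult_mat[of _ N N _ N _ N]
  have "\<not> scalar_matrix N T"
  proof
    assume "scalar_matrix N T"
    then obtain c where c: "T = c \<cdot>\<^sub>m 1\<^sub>m N" by (auto simp: scalar_matrix_def)
    have "M * T * L = M * L * F * (M * L)"
      unfolding T_def using M L(1) F by (simp add: assoc)
    also have "\<dots> = F" unfolding L(2) using F by simp
    finally have "F = c \<cdot>\<^sub>m 1\<^sub>m N"
      unfolding c using M L by (simp add: mult_smult_distrib[of _ N N _ N] mult_smult_assoc_mat[of _ N N _ N])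
    \<comment> \<open>A scalar \<open>F\<close> would have equal first and last diagonal entries,
      but \<open>0 < k < N\<close> makes them 1 and 0.\<close>
    then have "F $$ (0, 0) = c" "F $$ (N - 1, N - 1) = c" using k by auto
    moreover have "\<not> N - 1 < k" using k by simp
    ultimately show False using k by (simp add: F_def)
  qed
  moreover have "AE x in lebesgue. x \<in> J \<longrightarrow> T * W x = W x * mat_adjoint T"
    using eq
  proof eventually_elim
    case (elim x)
    show ?case
    proof
      assume x: "x \<in> J"
      define D where "D = M * W x * mat_adjoint M"
      have Dc: "D \<in> carrier_mat N N"
        using M W_carrier[OF x] by (auto simp: D_def intro!: mult_carrier_mat)
      have D_eq: "D = four_block_mat (V x) (0\<^sub>m k (dim_col (diag_block_mat (map (\<lambda>(k, V). V x) Vs'))))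
           (0\<^sub>m (dim_row (diag_block_mat (map (\<lambda>(k, V). V x) Vs'))) k) (diag_block_mat (map (\<lambda>(k, V). V x) Vs'))"
        using elim x V.W_carrier[OF x] by (simp add: D_def weight_direct_sum_def Vs_eq Let_def)
      have "D $$ (i, j) = 0" if "i < N" "j < N" "(i < k) \<noteq> (j < k)" for i j
      proof -
        have "i < dim_row D" "j < dim_col D" using that Dc by auto
        then show ?thesis using that V.W_carrier[OF x] unfolding D_eq by auto
      qed
      then have FD: "F * D = D * F" unfolding F_def by (rule block_projection_commute[OF Dc])
      have W: "W x \<in> carrier_mat N N" by (rule W_carrier[OF x])
      note adj = mat_adjoint_carrier[OF M(1)] mat_adjoint_carrier[OF L(1)]
      have LM: "mat_adjoint M * mat_adjoint L = 1\<^sub>m N"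
        unfolding mat_adjoint_mult[OF L(1) M(1), symmetric] L(3) by simp
      have Tadj: "mat_adjoint T = mat_adjoint M * (F * mat_adjoint L)"
        unfolding T_def mat_adjoint_mult[OF mult_carrier_mat[OF L(1) F] M(1)] mat_adjoint_mult[OF L(1) F] Fadj ..
      have WD: "W x = L * D * mat_adjoint L"
      proof -
        have "L * D * mat_adjoint L = (L * M) * W x * (mat_adjoint M * mat_adjoint L)"
          unfolding D_def using L(1) M(1) W adj by (simp add: assoc)
        then show ?thesis unfolding LM L(3) using W by simp
      qed
      \<comment> \<open>With \<open>W = L D L\<^sup>*\<close>, the product \<open>T W\<close> is
        \<open>L F D L\<^sup>*\<close>. Exchanging \<open>F\<close> and \<open>D\<close> and
        reinserting \<open>M L = 1\<close> turns it into \<open>W T\<^sup>*\<close>.\<close>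
      have "T * W x = L * F * (M * L) * D * mat_adjoint L"
        unfolding WD T_def using L(1) M(1) Dc F adj by (simp add: assoc)
      also have "\<dots> = L * (F * D) * mat_adjoint L"
        unfolding L(2) using L(1) F Dc adj by (simp add: assoc)
      also have "\<dots> = L * D * mat_adjoint (M * L) * F * mat_adjoint L"
        unfolding FD L(2) using L(1) F Dc adj by (simp add: assoc)
      also have "\<dots> = W x * mat_adjoint T"
        unfolding WD Tadj mat_adjoint_mult[OF M(1) L(1)] using L(1) M(1) Dc F adj by (simp add: assoc)
      finally show "T * W x = W x * mat_adjoint T" .
    qed
  qed
  ultimately show ?thesis using T by blast
qed

section \<open>Moments and the passage from the coefficients back to the weight\<close>

context weight_polys
begin

abbreviation power_mpoly :: "nat \<Rightarrow> complex poly mat" where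
  "power_mpoly n \<equiv> monom 1 n \<cdot>\<^sub>m 1\<^sub>m N"

text \<open>Since \<open>P 0\<close> is the identity, pairing powers of \<open>x\<close> with it
  gives the moments of \<open>W\<close>.\<close>

lemma ip_power:
  assumes "i < N" "j < N"
  shows "ip (power_mpoly n) (P 0) $$ (i, j) = (LINT x:J|lebesgue. of_real (x ^ n) * W x $$ (i, j))"
  unfolding ip_def mat_integral_index[OF assms]
proof (intro set_lebesgue_integral_cong allI impI)
  fix x assume x: "x \<in> J"
  have one: "mpoly_eval (1\<^sub>m N) x = 1\<^sub>m N" by (intro eq_matI) (auto simp: mpoly_eval_def)
  have "mpoly_eval (power_mpoly n) x * W x * mat_adjoint (mpoly_eval (P 0) x) = of_real (x ^ n) \<cdot>\<^sub>m W x"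
    unfolding mpoly_eval_smult P_0 one mat_adjoint_one
    using W_carrier[OF x] by (simp add: poly_monom mult_smult_assoc_mat[of _ N N _ N] right_mult_one_mat[of _ N N])
  then show "(mpoly_eval (power_mpoly n) x * W x * mat_adjoint (mpoly_eval (P 0) x)) $$ (i, j)
      = of_real (x ^ n) * W x $$ (i, j)"
    using W_carrier[OF x] assms by simp
qed auto

text \<open>The leading coefficient of a polynomial commuting with \<open>T\<close> commutes with
  \<open>T\<close>, so all coefficients of the expansion of \<open>F\<close> in the
  \<open>P n\<close> do. Pairing with \<open>P 0\<close> leaves only the coefficient of
  \<open>P 0\<close>, which serves as \<open>C\<close>.\<close>

lemma ip_P0_if_commute:
  assumes T: "T \<in> carrier_mat N N" and TP: "\<And>n. const_mpoly T * P n = P n * const_mpoly T"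
  shows "mpoly_deg_less N n F \<Longrightarrow> const_mpoly T * F = F * const_mpoly T
    \<Longrightarrow> \<exists>C \<in> carrier_mat N N. T * C = C * T \<and> ip F (P 0) = C * ip (P 0) (P 0)"
proof (induction n arbitrary: F)
  case 0
  then have F: "F = 0\<^sub>m N N" by (intro mpoly_deg_less_0)
  have "ip (0\<^sub>m N N - 0\<^sub>m N N) (P 0) = ip (0\<^sub>m N N) (P 0) - ip (0\<^sub>m N N) (P 0)"
    by (rule ip_minus_left) auto
  then have "ip F (P 0) = 0\<^sub>m N N" unfolding F by (simp add: minus_r_inv_mat[of _ N N])
  then show ?case using T by (intro bexI[of _ "0\<^sub>m N N"]) auto
next
  case (Suc n)
  define D where "D = mpoly_coeff F n"
  have F: "F \<in> carrier_mat N N" and D: "D \<in> carrier_mat N N"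
    using Suc.prems(1) by (auto simp: mpoly_deg_less_def D_def)
  have cT: "const_mpoly T \<in> carrier_mat N N" and cD: "const_mpoly D \<in> carrier_mat N N"
    using T D by simp_all
  have DP: "const_mpoly D * P n \<in> carrier_mat N N" by (rule mult_carrier_mat[OF cD P_carrier])
  have TD: "T * D = D * T"
    using mpoly_coeff_const_mult[OF T F, of n] mpoly_coeff_mult_const[OF F T, of n] Suc.prems(2)
    by (simp add: D_def)
  have "const_mpoly T * const_mpoly D = const_mpoly D * const_mpoly T"
    unfolding const_mpoly_mult[OF T D, symmetric] const_mpoly_mult[OF D T, symmetric] TD ..
  then have "const_mpoly T * (F - const_mpoly D * P n) = (F - const_mpoly D * P n) * const_mpoly T"
    by (intro mat_commute_minus[OF cT F DP Suc.prems(2)] mat_commute_mult[OF cT cD P_carrier] TP)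
  from Suc.IH[OF mpoly_deg_less_reduce[OF Suc.prems(1) P_monic, folded D_def] this]
  obtain C where C: "C \<in> carrier_mat N N" "T * C = C * T"
    and "ip (F - const_mpoly D * P n) (P 0) = C * ip (P 0) (P 0)" by blast
  then have diff: "ip F (P 0) - D * ip (P n) (P 0) = C * ip (P 0) (P 0)"
    by (simp only: ip_minus_left[OF F DP P_carrier] ip_const_left[OF D P_carrier P_carrier])
  have "ip F (P 0) = C * ip (P 0) (P 0) + D * ip (P n) (P 0)"
    unfolding diff[symmetric] using D by (intro eq_matI) auto
  \<comment> \<open>By orthogonality the peeled term \<open>D P\<^sub>n\<close> contributes only at
    \<open>n = 0\<close>.\<close>
  also have "\<dots> = (if n = 0 then C + D else C) * ip (P 0) (P 0)"
    using C D by (auto simp: ip_P add_mult_distrib_mat[of _ N N _ _ N] right_mult_zero_mat[of _ N N]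
        intro!: right_add_zero_mat mult_carrier_mat[of _ N N])
  finally show ?case
    using C D TD mat_commute_add[OF T C(1) D C(2) TD]
    by (intro bexI[of _ "if n = 0 then C + D else C"]) auto
qed

text \<open>If \<open>C\<close> annihilates this zeroth moment from the left, then the constant
  polynomial \<open>C\<close> is orthogonal to itself and vanishes by definiteness.\<close>

lemma ip_P0_invertible: "invertible_mat (ip (P 0) (P 0))"
proof (rule invertible_matI_left_cancel[OF ip_carrier])
  fix C assume C: "C \<in> carrier_mat N N" and zero: "C * ip (P 0) (P 0) = 0\<^sub>m N N"
  have CP: "const_mpoly C * P 0 \<in> carrier_mat N N" using C by (intro mult_carrier_mat[of _ N N]) auto
  have "ip (const_mpoly C * P 0) (const_mpoly C * P 0) = 0\<^sub>m N N"
    unfolding ip_const_right[OF C CP P_carrier] ip_const_left[OF C P_carrier P_carrier] zero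
    using C by (intro left_mult_zero_mat) simp
  then have "const_mpoly C * P 0 = 0\<^sub>m N N" by (rule ip_self_eq_zero[OF CP])
  moreover have "mpoly_coeff (const_mpoly C * P 0) 0 = C"
    unfolding mpoly_coeff_const_mult[OF C P_carrier] P_lead using C by simp
  ultimately show "C = 0\<^sub>m N N" by (auto simp: mpoly_coeff_def intro!: eq_matI)
qed

lemma commute_weight_if_commute_AB:
  assumes fin: "\<bar>a\<bar> \<noteq> \<infinity>" "\<bar>b\<bar> \<noteq> \<infinity>"
    and T: "T \<in> carrier_mat N N" and TAB: "\<And>n. T * A n = A n * T \<and> T * B n = B n * T"
  obtains U where "U \<in> carrier_mat N N" "AE x in lebesgue. x \<in> J \<longrightarrow> T * W x = W x * U"
proof -
  note assoc = assoc_mult_mat[of _ N N _ N _ N]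
  have TP: "const_mpoly T * P n = P n * const_mpoly T" for n
    by (rule commute_P_if_commute_AB[OF T TAB])
  define H where "H = ip (P 0) (P 0)"
  have H: "H \<in> carrier_mat N N" by (simp add: H_def)
  obtain L where L: "L \<in> carrier_mat N N" "H * L = 1\<^sub>m N" "L * H = 1\<^sub>m N"
    using invertible_matE[OF ip_P0_invertible ip_carrier] unfolding H_def by blast
  \<comment> \<open>Chosen so that \<open>H U = T H\<close>. The moments have the form
    \<open>C H\<close> with \<open>C\<close> commuting with \<open>T\<close>, so one
    \<open>U\<close> serves them all.\<close>
  define U where "U = L * (T * H)"
  have U: "U \<in> carrier_mat N N" using L T H by (auto simp: U_def intro!: mult_carrier_mat)
  have moments: "T * ip (power_mpoly n) (P 0) = ip (power_mpoly n) (P 0) * U" for n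
  proof -
    have "mpoly_coeff (power_mpoly n) k = 0\<^sub>m N N" if "Suc n \<le> k" for k
      using that by (intro eq_matI) (auto simp: mpoly_coeff_def)
    then have "mpoly_deg_less N (Suc n) (power_mpoly n)" by (simp add: mpoly_deg_less_def)
    moreover have "const_mpoly T * power_mpoly n = power_mpoly n * const_mpoly T"
      by (rule mat_commute_smult[of _ N]) (use T in auto)
    ultimately obtain C where C: "C \<in> carrier_mat N N" "T * C = C * T"
      and eq: "ip (power_mpoly n) (P 0) = C * H"
      using ip_P0_if_commute[OF T TP] unfolding H_def by blast
    have "T * (C * H) = C * T * H" using assoc_mult_mat[OF T C(1) H] C(2) by simp
    also have "\<dots> = C * (H * L) * (T * H)" unfolding L(2) using C T H by (simp add: assoc)
    also have "\<dots> = C * H * U" unfolding U_def using C T H L(1) by (simp add: assoc)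
    finally show ?thesis unfolding eq .
  qed
  \<comment> \<open>Finite endpoints place the interval inside a compact one, where moments
    determine an integrable function.\<close>
  obtain c d where cd: "a = ereal c" "b = ereal d" using fin by (cases a; cases b) auto
  have J_sub: "x \<in> {c..d}" if "x \<in> J" for x using that by (auto simp: cd)
  have "AE x in lebesgue. x \<in> J \<longrightarrow> (T * W x) $$ (i, j) = (W x * U) $$ (i, j)" if ij: "i < N" "j < N" for i j
  proof -
    \<comment> \<open>The \<open>(i, j)\<close> entry of \<open>T W - W U\<close>, extended by zero
      outside the interval. All its moments vanish by \<open>moments\<close>.\<close>
    define f where "f x = indicator J x *\<^sub>R
      ((\<Sum>k<N. T $$ (i, k) * W x $$ (k, j)) - (\<Sum>k<N. W x $$ (i, k) * U $$ (k, j)))" for x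
    have int: "set_integrable lebesgue J (\<lambda>x. of_real (x ^ n) * W x $$ (k, l))" if "k < N" "l < N" for n k l
      using moment_integrable[OF that] .
    have f_eq: "of_real (x ^ n) * f x = indicator J x *\<^sub>R
      ((\<Sum>k<N. T $$ (i, k) * (of_real (x ^ n) * W x $$ (k, j))) - (\<Sum>k<N. (of_real (x ^ n) * W x $$ (i, k)) * U $$ (k, j)))" for n x
      unfolding f_def mult_scaleR_right right_diff_distrib sum_distrib_left by (simp only: mult_ac)
    have int1: "set_integrable lebesgue J (\<lambda>x. \<Sum>k<N. T $$ (i, k) * (of_real (x ^ n) * W x $$ (k, j)))"
      and int2: "set_integrable lebesgue J (\<lambda>x. \<Sum>k<N. (of_real (x ^ n) * W x $$ (i, k)) * U $$ (k, j))" for n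
      using int ij by (auto intro!: set_integrable_sum simp del: of_real_power)
    have "AE x in lebesgue. f x = 0"
    proof (rule moments_zero_imp_AE_zero[of _ c d])
      show "integrable lebesgue (\<lambda>x. of_real (x ^ n) * f x)" for n
        using set_integral_diff(1)[OF int1[of n] int2[of n]] unfolding f_eq set_integrable_def .
      show "f x = 0" if "x \<notin> {c..d}" for x using that J_sub by (auto simp: f_def indicator_def)
      fix n
      have "(\<integral>x. of_real (x ^ n) * f x \<partial>lebesgue)
        = (LINT x:J|lebesgue. \<Sum>k<N. T $$ (i, k) * (of_real (x ^ n) * W x $$ (k, j)))
          - (LINT x:J|lebesgue. \<Sum>k<N. (of_real (x ^ n) * W x $$ (i, k)) * U $$ (k, j))"
        using set_integral_diff(2)[OF int1[of n] int2[of n]] unfolding f_eq set_lebesgue_integral_def .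
      also have "(LINT x:J|lebesgue. \<Sum>k<N. T $$ (i, k) * (of_real (x ^ n) * W x $$ (k, j)))
          = (\<Sum>k<N. T $$ (i, k) * ip (power_mpoly n) (P 0) $$ (k, j))"
        using ij int by (subst set_integral_sum) (auto simp: ip_power simp del: of_real_power)
      also have "(LINT x:J|lebesgue. \<Sum>k<N. (of_real (x ^ n) * W x $$ (i, k)) * U $$ (k, j))
          = (\<Sum>k<N. ip (power_mpoly n) (P 0) $$ (i, k) * U $$ (k, j))"
        using ij int by (subst set_integral_sum) (auto simp: ip_power simp del: of_real_power)
      also have "(\<Sum>k<N. T $$ (i, k) * ip (power_mpoly n) (P 0) $$ (k, j)) = (T * ip (power_mpoly n) (P 0)) $$ (i, j)"
        using ij T by (simp add: scalar_prod_def lessThan_atLeast0)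
      also have "(\<Sum>k<N. ip (power_mpoly n) (P 0) $$ (i, k) * U $$ (k, j)) = (ip (power_mpoly n) (P 0) * U) $$ (i, j)"
        using ij U by (simp add: scalar_prod_def lessThan_atLeast0)
      finally show "(\<integral>x. of_real (x ^ n) * f x \<partial>lebesgue) = 0" unfolding moments by simp
    qed
    then show ?thesis
    proof eventually_elim
      case (elim x)
      show ?case
      proof
        assume x: "x \<in> J"
        then show "(T * W x) $$ (i, j) = (W x * U) $$ (i, j)"
          using elim W_carrier[OF x] T U ij by (simp add: f_def scalar_prod_def lessThan_atLeast0)
      qed
    qed
  qed
  \<comment> \<open>The exceptional null set depends on \<open>(i, j)\<close>; the union over the
    countably many pairs is still null.\<close>
  then have "AE x in lebesgue. \<forall>i j. i < N \<longrightarrow> j < N \<longrightarrow> x \<in> J \<longrightarrow> (T * W x) $$ (i, j) = (W x * U) $$ (i, j)"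
    by (simp add: AE_all_countable)
  then have "AE x in lebesgue. x \<in> J \<longrightarrow> T * W x = W x * U"
  proof eventually_elim
    case (elim x)
    show ?case
    proof
      assume x: "x \<in> J"
      show "T * W x = W x * U"
        by (rule eq_matI) (use elim x W_carrier[OF x] T U in auto)
    qed
  qed
  then show ?thesis using U that by blast
qed

end

lemma (in weight) ex_selfadjoint_intertwiner:
  assumes T: "T \<in> carrier_mat N N" and ns: "\<not> scalar_matrix N T" and U: "U \<in> carrier_mat N N"
    and TU: "AE x in lebesgue. x \<in> J \<longrightarrow> T * W x = W x * U"
  obtains Y where "Y \<in> carrier_mat N N" "\<not> scalar_matrix N Y"
    "AE x in lebesgue. x \<in> J \<longrightarrow> W x * Y = mat_adjoint Y * W x"
proof -
  define T' U' where "T' = mat_adjoint T" and "U' = mat_adjoint U"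
  have c: "T' \<in> carrier_mat N N" "U' \<in> carrier_mat N N" using T U by (simp_all add: T'_def U'_def)
  have both: "AE x in lebesgue. x \<in> J \<longrightarrow> W x \<in> carrier_mat N N \<and> T * W x = W x * U \<and> U' * W x = W x * T'"
    using TU
  proof eventually_elim
    case (elim x)
    show ?case
    proof
      assume x: "x \<in> J"
      have W: "W x \<in> carrier_mat N N" by (rule W_carrier[OF x])
      have "mat_adjoint (T * W x) = mat_adjoint (W x * U)" using elim x by simp
      then have "W x * T' = U' * W x"
        unfolding mat_adjoint_mult[OF T W] mat_adjoint_mult[OF W U] pos_semidefinite_hermitian[OF W_semidef[OF x]]
        by (simp add: T'_def U'_def)
      then show "W x \<in> carrier_mat N N \<and> T * W x = W x * U \<and> U' * W x = W x * T'" using W elim x by simp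
    qed
  qed
  define Y1 where "Y1 = U + T'"
  define Y2 where "Y2 = \<i> \<cdot>\<^sub>m (U - T')"
  have Y: "Y1 \<in> carrier_mat N N" "Y2 \<in> carrier_mat N N"
    using U c by (auto simp: Y1_def Y2_def)
  have adj: "mat_adjoint Y1 = U' + T" "mat_adjoint Y2 = \<i> \<cdot>\<^sub>m (T - U')"
    using T U unfolding Y1_def Y2_def T'_def U'_def
    by (auto intro!: eq_matI simp: algebra_simps)
  have 1: "AE x in lebesgue. x \<in> J \<longrightarrow> W x * Y1 = mat_adjoint Y1 * W x"
    using both
  proof eventually_elim
    case (elim x)
    then show ?case
      unfolding adj unfolding Y1_def using T U c
      by (auto simp: mult_add_distrib_mat[of _ N N _ N] add_mult_distrib_mat[of _ N N _ _ N] intro!: comm_add_mat mult_carrier_mat)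
  qed
  have 2: "AE x in lebesgue. x \<in> J \<longrightarrow> W x * Y2 = mat_adjoint Y2 * W x"
    using both
  proof eventually_elim
    case (elim x)
    then show ?case
      unfolding adj unfolding Y2_def using T U c
      by (auto simp: mult_minus_distrib_mat[of _ N N _ N] minus_mult_distrib_mat[of _ N N _ _ N]
          mult_smult_distrib[OF _ minus_carrier_mat[OF c(1)]] mult_smult_assoc_mat[OF minus_carrier_mat[OF c(2)]])
  qed
  have "\<not> scalar_matrix N Y1 \<or> \<not> scalar_matrix N Y2"
  proof (rule ccontr)
    assume "\<not> (\<not> scalar_matrix N Y1 \<or> \<not> scalar_matrix N Y2)"
    then obtain p q where pq: "Y1 = p \<cdot>\<^sub>m 1\<^sub>m N" "Y2 = q \<cdot>\<^sub>m 1\<^sub>m N" by (auto simp: scalar_matrix_def)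
    \<comment> \<open>This is the identity \<open>2 T = Y1\<^sup>* - \<i> Y2\<^sup>*\<close> with
      the supposed scalar values of \<open>Y1\<close> and \<open>Y2\<close> inserted.\<close>
    have "T = ((cnj p - \<i> * cnj q) / 2 ) \<cdot>\<^sub>m 1\<^sub>m N"
    proof (rule eq_matI)
      fix i j assume "i < dim_row (((cnj p - \<i> * cnj q) / 2 ) \<cdot>\<^sub>m 1\<^sub>m N)" "j < dim_col (((cnj p - \<i> * cnj q) / 2 ) \<cdot>\<^sub>m 1\<^sub>m N)"
      then have ij: "i < N" "j < N" by auto
      have "(U' + T) $$ (i, j) = cnj p * 1\<^sub>m N $$ (i, j)"
        unfolding adj(1)[symmetric] pq mat_adjoint_smult mat_adjoint_one using ij by simp
      moreover have "(\<i> \<cdot>\<^sub>m (T - U')) $$ (i, j) = cnj q * 1\<^sub>m N $$ (i, j)"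
        unfolding adj(2)[symmetric] pq mat_adjoint_smult mat_adjoint_one using ij by simp
      ultimately have e: "U' $$ (i, j) + T $$ (i, j) = cnj p * 1\<^sub>m N $$ (i, j)"
        "\<i> * (T $$ (i, j) - U' $$ (i, j)) = cnj q * 1\<^sub>m N $$ (i, j)"
        using ij T c by auto
      have "2 * T $$ (i, j) = (U' $$ (i, j) + T $$ (i, j)) - \<i> * (\<i> * (T $$ (i, j) - U' $$ (i, j)))"
        by (simp flip: mult.assoc)
      also have "\<dots> = (cnj p - \<i> * cnj q) * 1\<^sub>m N $$ (i, j)"
        unfolding e by (simp add: algebra_simps)
      finally show "T $$ (i, j) = (((cnj p - \<i> * cnj q) / 2 ) \<cdot>\<^sub>m 1\<^sub>m N) $$ (i, j)"
        using ij by (simp add: field_simps)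
    qed (use T in auto)
    then show False using ns by (auto simp: scalar_matrix_def)
  qed
  then show ?thesis using that Y 1 2 by blast
qed

text \<open>The matrix \<open>M\<close> is found at one point \<open>x0\<close> where
  \<open>W\<close> is definite, but it clears the off-diagonal blocks for every \<open>V\<close>
  with \<open>V Y = Y\<^sup>* V\<close>. So this one \<open>M\<close> splits \<open>W x\<close> for
  almost all \<open>x\<close>.\<close>

lemma (in weight) reduces_if_selfadjoint_intertwiner:
  assumes Y: "Y \<in> carrier_mat N N" and ns: "\<not> scalar_matrix N Y"
    and WY: "AE x in lebesgue. x \<in> J \<longrightarrow> W x * Y = mat_adjoint Y * W x"
  shows "weight_reduces N a b W"
proof -
  have "AE x in lebesgue. x \<in> J \<longrightarrow> pos_definite N (W x) \<and> W x * Y = mat_adjoint Y * W x"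
    using W_pos_def WY by eventually_elim auto
  from AE_on_einterval_infinite[OF a_less_b this]
  obtain x0 where x0: "pos_definite N (W x0)" "W x0 * Y = mat_adjoint Y * W x0"
    using not_finite_existsD by fastforce
  obtain r M where r: "0 < r" "r < N" and M: "M \<in> carrier_mat N N" "invertible_mat M"
    and off: "\<And>V i j. V \<in> carrier_mat N N \<Longrightarrow> V * Y = mat_adjoint Y * V \<Longrightarrow> i < N \<Longrightarrow> j < N
       \<Longrightarrow> (i < r) \<noteq> (j < r) \<Longrightarrow> (M * V * mat_adjoint M) $$ (i, j) = 0"
    using ex_block_diagonalizing[OF x0(1) Y x0(2) ns N_pos] by blast
  obtain L where L: "L \<in> carrier_mat N N" "M * L = 1\<^sub>m N" by (rule invertible_matE[OF M(2,1)])
  define V where "V s k x = mat k k (\<lambda>(i, j). (M * W x * mat_adjoint M) $$ (i + s, j + s))" for s k x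
  have weights: "matrix_weight r a b (V 0 r)" "matrix_weight (N - r) a b (V r (N - r))"
    unfolding V_def by (rule weight_block[OF weight M(1) L]; use r in simp)+
  define Vs where "Vs = [(r, V 0 r), (N - r, V r (N - r))]"
  have "AE x in lebesgue. x \<in> J \<longrightarrow> weight_direct_sum Vs x = M * W x * mat_adjoint M"
    using WY
  proof eventually_elim
    case (elim x)
    show ?case
    proof
      assume x: "x \<in> J"
      have D: "M * W x * mat_adjoint M \<in> carrier_mat N N"
        using M W_carrier[OF x] by (auto intro!: mult_carrier_mat)
      show "weight_direct_sum Vs x = M * W x * mat_adjoint M"
      proof (rule eq_matI)
        fix i j assume "i < dim_row (M * W x * mat_adjoint M)" "j < dim_col (M * W x * mat_adjoint M)"
        then have ij: "i < N" "j < N" using D unfolding carrier_mat_def by auto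
        \<comment> \<open>Inside the two blocks the entries agree by construction; outside, the
          direct sum has zeros and \<open>off\<close> gives zero on the other side.\<close>
        show "weight_direct_sum Vs x $$ (i, j) = (M * W x * mat_adjoint M) $$ (i, j)"
          using ij r off[OF W_carrier[OF x] _ ij] elim x
          by (auto simp: weight_direct_sum_def Vs_def V_def)
      qed (use D r in \<open>auto simp: weight_direct_sum_def Vs_def V_def\<close>)
    qed
  qed
  then have "weight_equiv N a b W (weight_direct_sum Vs)"
    using M unfolding weight_equiv_def by blast
  moreover have "\<forall>(k, V) \<in> set Vs. k < N \<and> matrix_weight k a b V"
    using weights r by (simp add: Vs_def)
  moreover have "sum_list (map fst Vs) = N" using r by (simp add: Vs_def)
  ultimately show ?thesis unfolding weight_reduces_def by blast
qed

theorem theorem4p5: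
  fixes N :: nat and a b :: ereal and W :: "real \<Rightarrow> complex mat"
    and P :: "nat \<Rightarrow> complex poly mat" and A B :: "nat \<Rightarrow> complex mat"
  assumes "matrix_weight N a b W"
    and "monic_orthogonal_polys N a b W P"
    and "three_term_recursion N A B P"
  shows "(weight_reduces N a b W \<longrightarrow>
            (\<exists>T \<in> carrier_mat N N. \<not> scalar_matrix N T \<and>
               (\<forall>n. T * A n = A n * T \<and> T * B n = B n * T)))
       \<and> (\<bar>a\<bar> \<noteq> \<infinity> \<and> \<bar>b\<bar> \<noteq> \<infinity> \<longrightarrow>
            (\<exists>T \<in> carrier_mat N N. \<not> scalar_matrix N T \<and>
               (\<forall>n. T * A n = A n * T \<and> T * B n = B n * T)) \<longrightarrow>
            weight_reduces N a b W)"
proof -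
  interpret weight_polys N a b W P A B
    using assms by unfold_locales
  show ?thesis
  proof (intro conjI impI)
    assume "weight_reduces N a b W"
    then obtain T where T: "T \<in> carrier_mat N N" "\<not> scalar_matrix N T"
      and TW: "AE x in lebesgue. x \<in> J \<longrightarrow> T * W x = W x * mat_adjoint T"
      using commuting_matrix_if_reduces by blast
    have "T * A n = A n * T \<and> T * B n = B n * T" for n
      by (rule commute_AB_if_commute_P[OF T(1) commute_P_if_commute_weight[OF T(1) TW]])
    then show "\<exists>T \<in> carrier_mat N N. \<not> scalar_matrix N T \<and>
        (\<forall>n. T * A n = A n * T \<and> T * B n = B n * T)"
      using T by blast
  next
    assume fin: "\<bar>a\<bar> \<noteq> \<infinity> \<and> \<bar>b\<bar> \<noteq> \<infinity>"
      and "\<exists>T \<in> carrier_mat N N. \<not> scalar_matrix N T \<and> (\<forall>n. T * A n = A n * T \<and> T * B n = B n * T)"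
    then obtain T where T: "T \<in> carrier_mat N N" "\<not> scalar_matrix N T"
      and TAB: "\<And>n. T * A n = A n * T \<and> T * B n = B n * T" by blast
    obtain U where U: "U \<in> carrier_mat N N" and TU: "AE x in lebesgue. x \<in> J \<longrightarrow> T * W x = W x * U"
      by (rule commute_weight_if_commute_AB[OF _ _ T(1) TAB]) (use fin in auto)
    obtain Y where "Y \<in> carrier_mat N N" "\<not> scalar_matrix N Y"
      "AE x in lebesgue. x \<in> J \<longrightarrow> W x * Y = mat_adjoint Y * W x"
      by (rule ex_selfadjoint_intertwiner[OF T U TU])
    then show "weight_reduces N a b W" by (rule reduces_if_selfadjoint_intertwiner)
  qed
qed

end
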